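(* Let $\lambda\in 2\mathbb{Z}$. Then the $\mathfrak{sl}_2(\mathbb{C})$-module $M_\lambda^C=U(I_\lambda)/U(I_\lambda)C$ has a unique maximal submodule $N_\lambda^C$; this submodule is graded with respect to the $\mathbb{Z}_2^2$-grading of $M_\lambda^C$, and $N_\lambda^C=P\oplus Q$, where $P$ and $Q$ are simple $\mathfrak{sl}_2(\mathbb{C})$-modules of rank $1$.
   Context: Let $x=\begin{bmatrix}0&1\\0&0\end{bmatrix}$, $h=\begin{bmatrix}1&0\\0&-1\end{bmatrix}$, $y=\begin{bmatrix}0&0\\1&0\end{bmatrix}$ be the standard basis of $\mathfrak{sl}_2(\mathbb{C})$ and put $B=x+y=\begin{bmatrix}0&1\\1&0\end{bmatrix}$, $C=x-y=\begin{bmatrix}0&1\\-1&0\end{bmatrix}$. Let $c=(h+1)^2+4yx\in U(\mathfrak{sl}_2(\mathbb{C}))$ be the Casimir element. For $\lambda\in\mathbb{C}$, let $I_\lambda$ be the two-sided ideal of $U(\mathfrak{sl}_2(\mathbb{C}))$ generated by the central element $c-(\lambda+1)^2$, and let $U(I_\lambda)=U(\mathfrak{sl}_2(\mathbb{C}))/I_\lambda$. $M_\lambda^C=U(I_\lambda)/U(I_\lambda)C$ is the quotient of the left regular module by the left ideal generated by the image of $C$. The Pauli grading of $\mathfrak{sl}_2(\mathbb{C})$ by $\mathbb{Z}_2^2$ is $L_{(1,0)}=\langle h\rangle$, $L_{(0,1)}=\langle B\rangle$, $L_{(1,1)}=\langle C\rangle$. It extends uniquely to a $\mathbb{Z}_2^2$-grading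 of the associative algebra $U(\mathfrak{sl}_2(\mathbb{C}))$; the ideal $I_\lambda$ and the left ideal $U(I_\lambda)C$ are graded, so $U(I_\lambda)$ and $M_\lambda^C$ inherit $\mathbb{Z}_2^2$-gradings. A submodule $W$ of $M=\bigoplus_g M_g$ is graded if $W=\bigoplus_g (W\cap M_g)$. An $\mathfrak{sl}_2(\mathbb{C})$-module has rank $n$ if, as a $\mathbb{C}[h]$-module, it is free of rank $n$ (such modules are called torsion-free of rank $n$). Maximal submodule means maximal among proper submodules. *)

theory Defs
  imports
    "HOL-Analysis.Analysis"
    "HOL-Algebra.QuotRing"
    "HOL-Algebra.Module"
    "HOL-Computational_Algebra.Polynomial"
    "HOL-Library.Poly_Mapping"
    "HOL-Library.Product_Plus"
    "HOL-Library.Z2"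
begin

section \<open>Modules over a noncommutative ring\<close>

text \<open>The locale \<^locale>\<open>module\<close> requires a commutative ring of scalars. The record type of modules
  and the locale \<^locale>\<open>submodule\<close> do not, and are reused here.\<close>

locale left_module = R?: ring R + M?: abelian_group M
  for R (structure) and M :: "('a, 'b, 'm) module_scheme" (structure) +
  assumes smult_closed:
      "\<lbrakk>a \<in> carrier R; v \<in> carrier M\<rbrakk> \<Longrightarrow> a \<odot>\<^bsub>M\<^esub> v \<in> carrier M"
    and smult_l_distr:
      "\<lbrakk>a \<in> carrier R; b \<in> carrier R; v \<in> carrier M\<rbrakk> \<Longrightarrow>
        (a \<oplus>\<^bsub>R\<^esub> b) \<odot>\<^bsub>M\<^esub> v = a \<odot>\<^bsub>M\<^esub> v \<oplus>\<^bsub>M\<^esub> b \<odot>\<^bsub>M\<^esub> v"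
    and smult_r_distr:
      "\<lbrakk>a \<in> carrier R; v \<in> carrier M; w \<in> carrier M\<rbrakk> \<Longrightarrow>
        a \<odot>\<^bsub>M\<^esub> (v \<oplus>\<^bsub>M\<^esub> w) = a \<odot>\<^bsub>M\<^esub> v \<oplus>\<^bsub>M\<^esub> a \<odot>\<^bsub>M\<^esub> w"
    and smult_assoc:
      "\<lbrakk>a \<in> carrier R; b \<in> carrier R; v \<in> carrier M\<rbrakk> \<Longrightarrow>
        (a \<otimes>\<^bsub>R\<^esub> b) \<odot>\<^bsub>M\<^esub> v = a \<odot>\<^bsub>M\<^esub> (b \<odot>\<^bsub>M\<^esub> v)"
    and smult_one:
      "v \<in> carrier M \<Longrightarrow> \<one>\<^bsub>R\<^esub> \<odot>\<^bsub>M\<^esub> v = v"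

definition maximal_submodule ::
    "'b set \<Rightarrow> ('a, 'r) ring_scheme \<Rightarrow> ('a, 'b, 'm) module_scheme \<Rightarrow> bool" where
  "maximal_submodule N R M \<longleftrightarrow>
     submodule N R M \<and> N \<noteq> carrier M \<and>
     (\<forall>W. submodule W R M \<and> N \<subseteq> W \<longrightarrow> W = N \<or> W = carrier M)"

definition simple_module ::
    "('a, 'r) ring_scheme \<Rightarrow> ('a, 'b, 'm) module_scheme \<Rightarrow> bool" where
  "simple_module R M \<longleftrightarrow>
     left_module R M \<and> carrier M \<noteq> {\<zero>\<^bsub>M\<^esub>} \<and>
     (\<forall>W. submodule W R M \<longrightarrow> W = {\<zero>\<^bsub>M\<^esub>} \<or> W = carrier M)"

text \<open>\<open>W = (\<Oplus>g. W \<inter> G g)\<close>, where \<open>G\<close> is the family of homogeneous components of \<open>M\<close>.\<close>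

definition graded_submodule ::
    "(bit \<times> bit \<Rightarrow> 'b set) \<Rightarrow> 'b set \<Rightarrow> ('a, 'r) ring_scheme \<Rightarrow>
      ('a, 'b, 'm) module_scheme \<Rightarrow> bool" where
  "graded_submodule G W R M \<longleftrightarrow>
     submodule W R M \<and>
     (\<forall>w\<in>W. \<exists>!d. (\<forall>g. d g \<in> W \<inter> G g) \<and> w = (\<Oplus>\<^bsub>M\<^esub>g\<in>UNIV. d g))"

definition internal_direct_sum ::
    "('a, 'b, 'm) module_scheme \<Rightarrow> 'b set \<Rightarrow> 'b set \<Rightarrow> 'b set \<Rightarrow> bool" where
  "internal_direct_sum M N P Q \<longleftrightarrow> N = P <+>\<^bsub>M\<^esub> Q \<and> P \<inter> Q = {\<zero>\<^bsub>M\<^esub>}"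


section \<open>The Lie algebra and its Pauli grading\<close>

definition sl2 :: "(complex^2^2) set" where
  "sl2 = {A. trace A = 0}"

definition bracket :: "complex^2^2 \<Rightarrow> complex^2^2 \<Rightarrow> complex^2^2" where
  "bracket A B = A ** B - B ** A"

definition mscale :: "complex \<Rightarrow> complex^2^2 \<Rightarrow> complex^2^2" where
  "mscale a A = (\<chi> i j. a * A $ i $ j)"

definition mat_x :: "complex^2^2" where
  "mat_x = vector [vector [0, 1], vector [0, 0]]"

definition mat_h :: "complex^2^2" where
  "mat_h = vector [vector [1, 0], vector [0, -1]]"

definition mat_y :: "complex^2^2" where
  "mat_y = vector [vector [0, 0], vector [1, 0]]"

definition mat_B :: "complex^2^2" where
  "mat_B = mat_x + mat_y"

definition mat_C :: "complex^2^2" where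
  "mat_C = mat_x - mat_y"

text \<open>The group \<open>\<int>\<^sub>2 \<times> \<int>\<^sub>2\<close> is the additive group of \<^typ>\<open>bit \<times> bit\<close>.\<close>

definition pauli :: "bit \<times> bit \<Rightarrow> (complex^2^2) set" where
  "pauli g =
     (if g = (1, 0) then range (\<lambda>a. mscale a mat_h)
      else if g = (0, 1) then range (\<lambda>a. mscale a mat_B)
      else if g = (1, 1) then range (\<lambda>a. mscale a mat_C)
      else {0})"


section \<open>The universal enveloping algebra\<close>

datatype 'a free_monoid = Word (letters: "'a list")

instantiation free_monoid :: (type) monoid_add
begin

definition "0 = Word []"
definition "u + v = Word (letters u @ letters v)"

instance
  by standard (simp_all add: zero_free_monoid_def plus_free_monoid_def)

end

text \<open>The product of \<^typ>\<open>'k \<Rightarrow>\<^sub>0 complex\<close> is convolution along the addition of \<open>'k\<close>, here the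
  concatenation of words. So this is the free unital associative complex algebra on the set \<open>X\<close>.\<close>

type_synonym 'a words = "'a free_monoid \<Rightarrow>\<^sub>0 complex"

definition free_algebra :: "'a set \<Rightarrow> 'a words ring" where
  "free_algebra X =
     \<lparr>carrier = {p. \<forall>w\<in>Poly_Mapping.keys p. set (letters w) \<subseteq> X},
      mult = (*), one = 1, zero = 0, add = (+)\<rparr>"

definition fgen :: "'a \<Rightarrow> 'a words" where
  "fgen A = Poly_Mapping.single (Word [A]) 1"

definition fconst :: "complex \<Rightarrow> 'a words" where
  "fconst a = Poly_Mapping.single 0 a"

text \<open>\<open>U(sl\<^sub>2)\<close> is the tensor algebra of \<^const>\<open>sl2\<close> modulo \<open>A \<otimes> B - B \<otimes> A - [A, B]\<close>. The tensor algebra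
  itself is the free algebra on the underlying set of \<^const>\<open>sl2\<close> modulo the linearity relations.\<close>

definition uea_relations :: "(complex^2^2) words set" where
  "uea_relations =
     {fgen (A + B) - (fgen A + fgen B) | A B. A \<in> sl2 \<and> B \<in> sl2} \<union>
     {fgen (mscale a A) - fconst a * fgen A | a A. A \<in> sl2} \<union>
     {fgen A * fgen B - fgen B * fgen A - fgen (bracket A B) | A B. A \<in> sl2 \<and> B \<in> sl2}"

definition uea_ideal :: "(complex^2^2) words set" where
  "uea_ideal = Idl\<^bsub>free_algebra sl2\<^esub> uea_relations"

type_synonym uea = "(complex^2^2) words set"

definition U_sl2 :: "uea ring" where
  "U_sl2 = free_algebra sl2 Quot uea_ideal"

definition to_U :: "(complex^2^2) words \<Rightarrow> uea" where
  "to_U p = uea_ideal +>\<^bsub>free_algebra sl2\<^esub> p"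

definition \<iota> :: "complex^2^2 \<Rightarrow> uea" where
  "\<iota> A = to_U (fgen A)"

definition const_U :: "complex \<Rightarrow> uea" where
  "const_U a = to_U (fconst a)"

text \<open>A grading of the algebra \<^const>\<open>U_sl2\<close> that extends the Pauli grading has to contain, in degree \<open>g\<close>,
  the span of all products of homogeneous elements of \<^const>\<open>sl2\<close> whose degrees add up to \<open>g\<close>.
  These spans add up to \<^const>\<open>U_sl2\<close>, so they are the components of the only such grading.\<close>

definition homogeneous_words :: "bit \<times> bit \<Rightarrow> (complex^2^2) free_monoid set" where
  "homogeneous_words g =
     {Word As | As gs. list_all2 (\<lambda>A d. A \<in> pauli d) As gs \<and> sum_list gs = g}"

definition U_component :: "bit \<times> bit \<Rightarrow> uea set" where
  "U_component g = to_U ` {p. Poly_Mapping.keys p \<subseteq> homogeneous_words g}"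


section \<open>Rank\<close>

text \<open>The element \<open>p(h)\<close> of the subalgebra \<open>\<complex>[h]\<close> of \<^const>\<open>U_sl2\<close>.\<close>

definition poly_h :: "complex poly \<Rightarrow> uea" where
  "poly_h p = (\<Oplus>\<^bsub>U_sl2\<^esub>i\<in>{..degree p}. const_U (poly.coeff p i) \<otimes>\<^bsub>U_sl2\<^esub> (\<iota> mat_h [^]\<^bsub>U_sl2\<^esub> (i::nat)))"

text \<open>\<open>\<complex>[h]\<close>-freeness of rank \<open>n\<close>: there is a basis \<open>b 0, \<dots>, b (n - 1)\<close> over \<open>\<complex>[h]\<close>.\<close>

definition has_rank :: "(uea, 'b, 'm) module_scheme \<Rightarrow> nat \<Rightarrow> bool" where
  "has_rank M n \<longleftrightarrow>
     (\<exists>b \<in> {..<n} \<rightarrow> carrier M. \<forall>v\<in>carrier M.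
        \<exists>!p. p \<in> {..<n} \<rightarrow>\<^sub>E (UNIV :: complex poly set) \<and>
             v = (\<Oplus>\<^bsub>M\<^esub>i\<in>{..<n}. poly_h (p i) \<odot>\<^bsub>M\<^esub> b i))"


section \<open>The module\<close>

definition casimir :: uea where
  "casimir =
     (\<iota> mat_h \<oplus>\<^bsub>U_sl2\<^esub> \<one>\<^bsub>U_sl2\<^esub>) [^]\<^bsub>U_sl2\<^esub> (2::nat) \<oplus>\<^bsub>U_sl2\<^esub> const_U 4 \<otimes>\<^bsub>U_sl2\<^esub> (\<iota> mat_y \<otimes>\<^bsub>U_sl2\<^esub> \<iota> mat_x)"

definition I_ideal :: "complex \<Rightarrow> uea set" where
  "I_ideal l = Idl\<^bsub>U_sl2\<^esub> {casimir \<ominus>\<^bsub>U_sl2\<^esub> const_U ((l + 1)\<^sup>2)}"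

definition U_I :: "complex \<Rightarrow> uea set ring" where
  "U_I l = U_sl2 Quot I_ideal l"

definition to_U_I :: "complex \<Rightarrow> uea \<Rightarrow> uea set" where
  "to_U_I l u = I_ideal l +>\<^bsub>U_sl2\<^esub> u"

definition left_ideal_C :: "complex \<Rightarrow> uea set set" where
  "left_ideal_C l = {u \<otimes>\<^bsub>U_I l\<^esub> to_U_I l (\<iota> mat_C) | u. u \<in> carrier (U_I l)}"

text \<open>The quotient of the left regular module of \<^term>\<open>U_I l\<close> by \<^term>\<open>left_ideal_C l\<close>, as a module
  over \<^const>\<open>U_sl2\<close>, that is, as an \<open>sl\<^sub>2\<close>-module. The union in the scalar multiplication is over equal
  cosets, as in \<^const>\<open>rcoset_mult\<close>. The fields \<^const>\<open>mult\<close> and \<^const>\<open>one\<close> are inherited from the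
  record type of rings and play no role in a module.\<close>

definition M_C :: "complex \<Rightarrow> (uea, uea set set) module" where
  "M_C l =
     \<lparr>carrier = a_rcosets\<^bsub>U_I l\<^esub> (left_ideal_C l),
      mult = undefined, one = undefined,
      zero = left_ideal_C l, add = set_add (U_I l),
      smult = (\<lambda>u X. \<Union>v\<in>X. left_ideal_C l +>\<^bsub>U_I l\<^esub> (to_U_I l u \<otimes>\<^bsub>U_I l\<^esub> v))\<rparr>"

definition M_C_component :: "complex \<Rightarrow> bit \<times> bit \<Rightarrow> uea set set set" where
  "M_C_component l g = (\<lambda>u. left_ideal_C l +>\<^bsub>U_I l\<^esub> to_U_I l u) ` U_component g"

end

theory Submission
  imports Defs
begin

text \<open>
  Put \<open>E = (h + iB)/2\<close>, \<open>F = (h - iB)/2\<close>, \<open>H = -iC\<close>. This is an \<open>sl\<^sub>2\<close>-triple, and \<open>C\<close> kills the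
  generator of the module, so the module is a sum of weight spaces for \<open>H\<close>. The number \<open>(l + 1)\<^sup>2\<close> is the
  square of an odd number \<open>2s - 1\<close> with \<open>s \<ge> 1\<close>, and the module has a basis \<open>v\<^sub>n\<close> (\<open>n \<in> \<int>\<close>) with
  \<open>E v\<^sub>n = (s + n) v\<^bsub>n+1\<^esub>\<close>, \<open>F v\<^sub>n = (s - n) v\<^bsub>n-1\<^esub>\<close>, \<open>H v\<^sub>n = 2n v\<^sub>n\<close>. The words \<open>E\<^sup>n\<close> and \<open>F\<^sup>n\<close> span
  the module by the Casimir relation, and the action on finitely supported functions on \<open>\<int>\<close> given by
  these formulas shows that they are independent.

  Every submodule is spanned by some of the \<open>v\<^sub>n\<close>. One containing \<open>v\<^sub>n\<close> with \<open>|n| < s\<close> contains the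
  generator \<open>v\<^sub>0\<close>, so the span of the other \<open>v\<^sub>n\<close> is the unique maximal submodule. It is the sum of
  the span \<open>P\<close> of the \<open>v\<^sub>n\<close> with \<open>n \<ge> s\<close> and the span \<open>Q\<close> of those with \<open>n \<le> -s\<close>, which are simple.
  Since \<open>h = E + F\<close>, the vector \<open>h\<^sup>i v\<^sub>s\<close> has leading term a nonzero multiple of \<open>v\<^bsub>s+i\<^esub>\<close>, so \<open>v\<^sub>s\<close> is a
  basis of \<open>P\<close> over \<open>\<complex>[h]\<close>, and likewise for \<open>Q\<close>. The grading is given by the parity of \<open>n\<close> and the
  reflection \<open>v\<^sub>n \<mapsto> v\<^bsub>-n\<^esub>\<close>, both of which preserve the maximal submodule.
\<close>

section \<open>The free algebra and its actions\<close>

definition words_over :: "'a set \<Rightarrow> 'a words set" where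
  "words_over X = {p. \<forall>w\<in>Poly_Mapping.keys p. set (letters w) \<subseteq> X}"

lemma free_algebra_simps [simp]:
  "carrier (free_algebra X) = words_over X"
  "mult (free_algebra X) = (*)" "one (free_algebra X) = 1"
  "zero (free_algebra X) = 0" "add (free_algebra X) = (+)"
  by (simp_all add: free_algebra_def words_over_def)

lemma words_over_iff: "p \<in> words_over X \<longleftrightarrow> (\<forall>w\<in>Poly_Mapping.keys p. set (letters w) \<subseteq> X)"
  by (simp add: words_over_def)

lemma letters_zero [simp]: "letters 0 = []"
  and letters_plus [simp]: "letters (u + v) = letters u @ letters v"
  by (simp_all add: zero_free_monoid_def plus_free_monoid_def)

lemma words_over_add [intro, simp]: "p \<in> words_over X \<Longrightarrow> q \<in> words_over X \<Longrightarrow> p + q \<in> words_over X"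
  using Poly_Mapping.keys_add[of p q] by (auto simp: words_over_iff)

lemma words_over_uminus [intro, simp]: "p \<in> words_over X \<Longrightarrow> - p \<in> words_over X"
  by (simp add: words_over_iff in_keys_iff)

lemma words_over_diff [intro, simp]: "p \<in> words_over X \<Longrightarrow> q \<in> words_over X \<Longrightarrow> p - q \<in> words_over X"
  using words_over_add[of p X "- q"] words_over_uminus[of q X] by simp

lemma words_over_mult [intro, simp]: "p \<in> words_over X \<Longrightarrow> q \<in> words_over X \<Longrightarrow> p * q \<in> words_over X"
  using Poly_Mapping.keys_mult[of p q] by (fastforce simp: words_over_iff)

lemma words_over_zero [intro, simp]: "0 \<in> words_over X"
  and words_over_one [intro, simp]: "1 \<in> words_over X"
  and words_over_fconst [intro, simp]: "fconst a \<in> words_over X"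
  by (simp_all add: words_over_iff fconst_def)

lemma words_over_fgen [intro, simp]: "A \<in> X \<Longrightarrow> fgen A \<in> words_over X"
  by (simp add: words_over_iff fgen_def)

lemma words_over_power [intro, simp]: "p \<in> words_over X \<Longrightarrow> p ^ n \<in> words_over X"
  by (induction n) auto

lemma words_over_sum [intro, simp]: "(\<And>i. i \<in> I \<Longrightarrow> f i \<in> words_over X) \<Longrightarrow> sum f I \<in> words_over X"
  by (induction I rule: infinite_finite_induct) auto

lemma ring_free_algebra: "ring (free_algebra X)"
proof (rule ringI)
  show "abelian_group (free_algebra X)"
  proof (rule abelian_groupI)
    fix p assume "p \<in> carrier (free_algebra X)"
    then show "\<exists>q\<in>carrier (free_algebra X). q \<oplus>\<^bsub>free_algebra X\<^esub> p = \<zero>\<^bsub>free_algebra X\<^esub>"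
      by (intro bexI[of _ "- p"]) auto
  qed (auto simp: add_ac)
  show "monoid (free_algebra X)"
    by (rule monoidI) (auto simp: mult.assoc)
qed (auto simp: algebra_simps)

lemma fconst_add: "fconst a + fconst b = fconst (a + b)"
  and fconst_diff: "fconst a - fconst b = fconst (a - b)"
  and fconst_mult: "fconst a * fconst b = fconst (a * b)"
  and fconst_uminus: "- fconst a = fconst (- a)"
  and fconst_one: "fconst 1 = 1"
  and fconst_zero: "fconst 0 = 0"
  and fconst_numeral: "fconst (numeral k) = numeral k"
  by (simp_all add: fconst_def single_add single_diff mult_single single_uminus)

text \<open>A finitely supported map arises from updates at fresh keys, and such an update adds one
  monomial.\<close>

lemma words_induct [case_names single add]:
  fixes p :: "'a words"
  assumes "\<And>w a. P (Poly_Mapping.single w a)" and "\<And>p q. P p \<Longrightarrow> P q \<Longrightarrow> P (p + q)"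
  shows "P p"
proof (induction p rule: update_induct)
  case const
  then show ?case using assms(1)[of 0 0] by simp
next
  case (update f a b)
  have "Poly_Mapping.update a b f = f + Poly_Mapping.single a b"
    using update.hyps by (intro poly_mapping_eqI) (auto simp: lookup_update lookup_add lookup_single when_def in_keys_iff)
  then show ?case using assms update.IH by simp
qed

text \<open>Scalars sit on the empty word, which is neutral for concatenation, so they are central
  although letters do not commute.\<close>

lemma fconst_commute: "p * fconst a = fconst a * p"
  by (induction p rule: words_induct) (simp_all add: fconst_def mult_single mult.commute algebra_simps)

lemma single_Cons:
  "Poly_Mapping.single (Word (A # As)) a = fgen A * Poly_Mapping.single (Word As) a"
  by (simp add: fgen_def mult_single plus_free_monoid_def)

lemma single_Nil: "Poly_Mapping.single (Word []) a = fconst a"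
  by (simp add: fconst_def zero_free_monoid_def)

text \<open>The induction adds one letter on the left, which matches left multiplication in the
  algebra and one further operator in an action.\<close>

lemma words_over_induct [consumes 1, case_names const gen add]:
  assumes "p \<in> words_over X"
    and const: "\<And>a. P (fconst a)"
    and gen: "\<And>A p. A \<in> X \<Longrightarrow> p \<in> words_over X \<Longrightarrow> P p \<Longrightarrow> P (fgen A * p)"
    and add: "\<And>p q. p \<in> words_over X \<Longrightarrow> q \<in> words_over X \<Longrightarrow> P p \<Longrightarrow> P q \<Longrightarrow> P (p + q)"
  shows "P p"
proof -
  have word: "Poly_Mapping.single (Word As) a \<in> words_over X \<and> P (Poly_Mapping.single (Word As) a)"
    if "set As \<subseteq> X" for As a
    using that
  proof (induction As)
    case Nil
    then show ?case by (simp add: single_Nil const)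
  next
    case (Cons A As)
    then show ?case by (auto simp: single_Cons intro: gen)
  qed
  have "(\<forall>w\<in>Poly_Mapping.keys p. set (letters w) \<subseteq> X) \<Longrightarrow> p \<in> words_over X \<and> P p"
  proof (induction p rule: update_induct)
    case const
    then show ?case using assms(2)[of 0] by (simp add: fconst_zero)
  next
    case (update f a b)
    have eq: "Poly_Mapping.update a b f = f + Poly_Mapping.single a b"
      using update(1) by (intro poly_mapping_eqI) (auto simp: lookup_update lookup_add lookup_single when_def in_keys_iff)
    have "set (letters a) \<subseteq> X" "\<forall>w\<in>Poly_Mapping.keys f. set (letters w) \<subseteq> X"
      using update(1,2,4) by (auto simp: keys_update)
    then show ?case
      using word[of "letters a" b] update(3) unfolding eq by (auto intro: add)
  qed
  then show ?thesis using assms(1) by (simp add: words_over_iff)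
qed

section \<open>Extension of a family of operators to the free algebra\<close>

definition algebra_action ::
    "('a \<Rightarrow> ('b \<Rightarrow> complex) \<Rightarrow> 'b \<Rightarrow> complex) \<Rightarrow> 'a words \<Rightarrow> ('b \<Rightarrow> complex) \<Rightarrow> 'b \<Rightarrow> complex" where
  "algebra_action r p f =
     (\<lambda>n. \<Sum>w\<in>Poly_Mapping.keys p. Poly_Mapping.lookup p w * foldr r (letters w) f n)"

lemma algebra_action_superset:
  assumes "finite S" "Poly_Mapping.keys p \<subseteq> S"
  shows "algebra_action r p f n = (\<Sum>w\<in>S. Poly_Mapping.lookup p w * foldr r (letters w) f n)"
  unfolding algebra_action_def using assms
  by (intro sum.mono_neutral_left) (auto simp: in_keys_iff)

lemma algebra_action_add:
  "algebra_action r (p + q) f = (\<lambda>n. algebra_action r p f n + algebra_action r q f n)"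
proof
  fix n
  let ?S = "Poly_Mapping.keys p \<union> Poly_Mapping.keys q"
  show "algebra_action r (p + q) f n = algebra_action r p f n + algebra_action r q f n"
    using Poly_Mapping.keys_add[of p q]
    by (simp add: algebra_action_superset[of ?S] lookup_add distrib_right sum.distrib)
qed

lemma algebra_action_single:
  "algebra_action r (Poly_Mapping.single w a) f = (\<lambda>n. a * foldr r (letters w) f n)"
  by (auto simp: algebra_action_def fun_eq_iff)

lemma algebra_action_fconst [simp]: "algebra_action r (fconst a) f = (\<lambda>n. a * f n)"
  by (simp add: fconst_def algebra_action_single)

lemma algebra_action_fgen [simp]: "algebra_action r (fgen A) f = r A f"
  by (simp add: fgen_def algebra_action_single)

lemma algebra_action_zero [simp]: "algebra_action r 0 f = (\<lambda>n. 0)"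
  by (simp add: algebra_action_def)

lemma algebra_action_one [simp]: "algebra_action r 1 f = f"
  using algebra_action_fconst[of r 1 f] by (simp add: fconst_one)

lemma algebra_action_uminus: "algebra_action r (- p) f = (\<lambda>n. - algebra_action r p f n)"
  by (simp add: algebra_action_def sum_negf)

lemma algebra_action_diff:
  "algebra_action r (p - q) f = (\<lambda>n. algebra_action r p f n - algebra_action r q f n)"
  using algebra_action_add[of r p "- q" f] by (simp add: algebra_action_uminus)

definition linear_map :: "(('b \<Rightarrow> complex) \<Rightarrow> ('b \<Rightarrow> complex)) \<Rightarrow> bool" where
  "linear_map T \<longleftrightarrow> (\<forall>f g. T (\<lambda>n. f n + g n) = (\<lambda>n. T f n + T g n)) \<and>
     (\<forall>a f. T (\<lambda>n. a * f n) = (\<lambda>n. a * T f n))"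

lemma linear_map_foldr: "(\<And>A. linear_map (r A)) \<Longrightarrow> linear_map (foldr r As)"
  by (induction As) (simp_all add: linear_map_def)

lemma linear_map_action:
  assumes "\<And>A. linear_map (r A)"
  shows "linear_map (algebra_action r p)"
  using linear_map_foldr[of r, OF assms]
  by (auto simp: linear_map_def algebra_action_def fun_eq_iff distrib_left sum.distrib sum_distrib_left mult.left_commute)

text \<open>On monomials, concatenation becomes composition because \<open>foldr\<close> applies the
  last letter first. Linearity of the operators lets the sums and coefficients of the right factor
  pass through the left factor.\<close>

lemma algebra_action_mult:
  assumes r: "\<And>A. linear_map (r A)"
  shows "algebra_action r (p * q) f = algebra_action r p (algebra_action r q f)"
proof (induction p rule: words_induct)
  case (single u a)
  show ?case
  proof (induction q rule: words_induct)
    case (single v b)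
    show ?case
      using linear_map_foldr[of r, OF r]
      by (simp add: mult_single algebra_action_single linear_map_def mult.assoc)
  next
    case (add q q')
    then show ?case
      using linear_map_action[of r, OF r]
      by (simp add: distrib_left algebra_action_add linear_map_def)
  qed
next
  case (add p p')
  then show ?case by (simp add: distrib_right algebra_action_add)
qed

section \<open>The quotients of the free algebra\<close>

lemma sl2_iff: "A \<in> sl2 \<longleftrightarrow> A $ 2 $ 2 = - A $ 1 $ 1"
  by (auto simp: sl2_def trace_def sum_2 eq_neg_iff_add_eq_0 add.commute)

lemma sl2_add [intro]: "A \<in> sl2 \<Longrightarrow> B \<in> sl2 \<Longrightarrow> A + B \<in> sl2"
  by (simp add: sl2_iff)

lemma sl2_mscale [intro]: "A \<in> sl2 \<Longrightarrow> mscale a A \<in> sl2"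
  by (simp add: sl2_iff mscale_def)

lemma sl2_bracket [intro]: "bracket A B \<in> sl2"
  by (simp add: sl2_iff bracket_def matrix_matrix_mult_def sum_2)

lemma mat_entries [simp]:
  "mat_x $ 1 $ 1 = 0" "mat_x $ 1 $ 2 = 1" "mat_x $ 2 $ 1 = 0" "mat_x $ 2 $ 2 = 0"
  "mat_h $ 1 $ 1 = 1" "mat_h $ 1 $ 2 = 0" "mat_h $ 2 $ 1 = 0" "mat_h $ 2 $ 2 = -1"
  "mat_y $ 1 $ 1 = 0" "mat_y $ 1 $ 2 = 0" "mat_y $ 2 $ 1 = 1" "mat_y $ 2 $ 2 = 0"
  "mat_B $ 1 $ 1 = 0" "mat_B $ 1 $ 2 = 1" "mat_B $ 2 $ 1 = 1" "mat_B $ 2 $ 2 = 0"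
  "mat_C $ 1 $ 1 = 0" "mat_C $ 1 $ 2 = 1" "mat_C $ 2 $ 1 = -1" "mat_C $ 2 $ 2 = 0"
  by (simp_all add: mat_x_def mat_h_def mat_y_def mat_B_def mat_C_def vector_2)

lemma mat_in_sl2 [simp, intro]:
  "mat_x \<in> sl2" "mat_h \<in> sl2" "mat_y \<in> sl2" "mat_B \<in> sl2" "mat_C \<in> sl2"
  by (simp_all add: sl2_iff)

section \<open>The enveloping algebra as a quotient of the free algebra\<close>

lemma uea_relations_subset: "uea_relations \<subseteq> words_over sl2"
  by (auto simp: uea_relations_def)

lemma ideal_uea_ideal: "ideal uea_ideal (free_algebra sl2)"
  unfolding uea_ideal_def
  by (rule ring.genideal_ideal[OF ring_free_algebra]) (use uea_relations_subset in simp)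

lemma ring_U_sl2: "ring U_sl2"
  unfolding U_sl2_def by (rule ideal.quotient_is_ring[OF ideal_uea_ideal])

lemma carrier_Quot: "carrier (R Quot I) = (\<lambda>a. I +>\<^bsub>R\<^esub> a) ` carrier R"
  by (auto simp: FactRing_def A_RCOSETS_def')

lemma carrier_U_sl2: "carrier U_sl2 = to_U ` words_over sl2"
  by (auto simp: U_sl2_def carrier_Quot to_U_def)

lemma ring_hom_to_U: "ring_hom_ring (free_algebra sl2) U_sl2 to_U"
  using ideal.rcos_ring_hom_ring[OF ideal_uea_ideal] by (simp add: U_sl2_def to_U_def [abs_def])

lemma to_U_add: "p \<in> words_over sl2 \<Longrightarrow> q \<in> words_over sl2 \<Longrightarrow> to_U (p + q) = to_U p \<oplus>\<^bsub>U_sl2\<^esub> to_U q"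
  and to_U_mult: "p \<in> words_over sl2 \<Longrightarrow> q \<in> words_over sl2 \<Longrightarrow> to_U (p * q) = to_U p \<otimes>\<^bsub>U_sl2\<^esub> to_U q"
  and to_U_one: "to_U 1 = \<one>\<^bsub>U_sl2\<^esub>"
  and to_U_zero: "to_U 0 = \<zero>\<^bsub>U_sl2\<^esub>"
proof -
  interpret ring_hom_ring "free_algebra sl2" U_sl2 to_U by (rule ring_hom_to_U)
  show "p \<in> words_over sl2 \<Longrightarrow> q \<in> words_over sl2 \<Longrightarrow> to_U (p + q) = to_U p \<oplus>\<^bsub>U_sl2\<^esub> to_U q"
    using hom_add[of p q] by simp
  show "p \<in> words_over sl2 \<Longrightarrow> q \<in> words_over sl2 \<Longrightarrow> to_U (p * q) = to_U p \<otimes>\<^bsub>U_sl2\<^esub> to_U q"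
    using hom_mult[of p q] by simp
  show "to_U 1 = \<one>\<^bsub>U_sl2\<^esub>" using hom_one by simp
  show "to_U 0 = \<zero>\<^bsub>U_sl2\<^esub>" using hom_zero by simp
qed

lemma to_U_closed: "p \<in> words_over sl2 \<Longrightarrow> to_U p \<in> carrier U_sl2"
  by (simp add: carrier_U_sl2)

lemma to_U_uminus: assumes "p \<in> words_over sl2" shows "to_U (- p) = \<ominus>\<^bsub>U_sl2\<^esub> to_U p"
proof -
  interpret U: ring U_sl2 by (rule ring_U_sl2)
  have "to_U (- p) \<oplus>\<^bsub>U_sl2\<^esub> to_U p = \<zero>\<^bsub>U_sl2\<^esub>"
    using assms by (simp add: words_over_uminus flip: to_U_add to_U_zero)
  then show ?thesis
    using U.minus_equality[of "to_U (- p)" "to_U p"] assms by (simp add: words_over_uminus to_U_closed)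
qed

lemma to_U_diff:
  "p \<in> words_over sl2 \<Longrightarrow> q \<in> words_over sl2 \<Longrightarrow> to_U (p - q) = to_U p \<ominus>\<^bsub>U_sl2\<^esub> to_U q"
  using to_U_add[of p "- q"] by (simp add: words_over_uminus to_U_uminus a_minus_def)

lemma to_U_power: assumes "p \<in> words_over sl2" shows "to_U (p ^ n) = to_U p [^]\<^bsub>U_sl2\<^esub> n"
proof -
  interpret U: ring U_sl2 by (rule ring_U_sl2)
  show ?thesis
    using assms by (induction n) (auto simp: to_U_one to_U_mult words_over_power power_Suc2 simp del: power_Suc)
qed

lemma words_over_fgen_sl2 [simp]: "fgen mat_h \<in> words_over sl2" "fgen mat_x \<in> words_over sl2" "fgen mat_y \<in> words_over sl2"
    "fgen mat_B \<in> words_over sl2" "fgen mat_C \<in> words_over sl2"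
  by auto

section \<open>The Casimir relation and the algebra \<open>U_I\<close>\<close>

lemma casimir_eq:
  "casimir = to_U ((fgen mat_h + 1)\<^sup>2 + fconst 4 * (fgen mat_y * fgen mat_x))"
  by (simp add: casimir_def \<iota>_def const_U_def to_U_add to_U_mult to_U_power to_U_one words_over_power words_over_add words_over_mult)

text \<open>A representative in the free algebra of the generator of \<open>I_ideal\<close>.
  Computations in both quotients are carried out on such words.\<close>

definition casimir_relation :: "complex \<Rightarrow> (complex^2^2) words" where
  "casimir_relation l =
     (fgen mat_h + 1)\<^sup>2 + fconst 4 * (fgen mat_y * fgen mat_x) - fconst ((l + 1)\<^sup>2)"

lemma words_over_casimir_relation: "casimir_relation l \<in> words_over sl2"
  by (auto simp: casimir_relation_def)

lemma I_ideal_eq: "I_ideal l = Idl\<^bsub>U_sl2\<^esub> {to_U (casimir_relation l)}"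
  unfolding I_ideal_def casimir_eq casimir_relation_def const_U_def
  by (subst to_U_diff) auto

lemma ideal_I_ideal: "ideal (I_ideal l) U_sl2"
  unfolding I_ideal_eq
  by (rule ring.genideal_ideal[OF ring_U_sl2]) (simp add: to_U_closed words_over_casimir_relation)

lemma ring_U_I: "ring (U_I l)"
  unfolding U_I_def by (rule ideal.quotient_is_ring[OF ideal_I_ideal])

definition word_I :: "complex \<Rightarrow> (complex^2^2) words \<Rightarrow> uea set" where
  "word_I l p = to_U_I l (to_U p)"

lemma ring_hom_word_I: "ring_hom_ring (free_algebra sl2) (U_I l) (word_I l)"
proof (rule ring_hom_ringI2[OF ring_free_algebra ring_U_I])
  have "to_U_I l \<in> ring_hom U_sl2 (U_I l)"
    using ideal.rcos_ring_hom[OF ideal_I_ideal] by (simp add: U_I_def to_U_I_def [abs_def])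
  from ring_hom_trans[OF ring_hom_ring.homh[OF ring_hom_to_U] this]
  show "word_I l \<in> ring_hom (free_algebra sl2) (U_I l)"
    by (simp add: word_I_def [abs_def] comp_def)
qed

lemma carrier_U_I: "carrier (U_I l) = word_I l ` words_over sl2"
  by (auto simp: U_I_def carrier_Quot carrier_U_sl2 word_I_def to_U_I_def)

context
  fixes l :: complex
begin

interpretation hom: ring_hom_ring "free_algebra sl2" "U_I l" "word_I l"
  by (rule ring_hom_word_I)

lemma word_I_add: "p \<in> words_over sl2 \<Longrightarrow> q \<in> words_over sl2 \<Longrightarrow> word_I l (p + q) = word_I l p \<oplus>\<^bsub>U_I l\<^esub> word_I l q"
  using hom.hom_add[of p q] by simp

lemma word_I_mult: "p \<in> words_over sl2 \<Longrightarrow> q \<in> words_over sl2 \<Longrightarrow> word_I l (p * q) = word_I l p \<otimes>\<^bsub>U_I l\<^esub> word_I l q"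
  using hom.hom_mult[of p q] by simp

lemma word_I_zero: "word_I l 0 = \<zero>\<^bsub>U_I l\<^esub>"
  using hom.hom_zero by simp

lemma word_I_closed: "p \<in> words_over sl2 \<Longrightarrow> word_I l p \<in> carrier (U_I l)"
  by (simp add: carrier_U_I)

lemma word_I_uminus: assumes "p \<in> words_over sl2" shows "word_I l (- p) = \<ominus>\<^bsub>U_I l\<^esub> word_I l p"
proof -
  have "word_I l (- p) \<oplus>\<^bsub>U_I l\<^esub> word_I l p = \<zero>\<^bsub>U_I l\<^esub>"
    using assms by (simp add: words_over_uminus flip: word_I_add word_I_zero)
  then show ?thesis
    using hom.S.minus_equality[of "word_I l (- p)" "word_I l p"] assms by (simp add: words_over_uminus word_I_closed)
qed

lemma word_I_diff:
  "p \<in> words_over sl2 \<Longrightarrow> q \<in> words_over sl2 \<Longrightarrow> word_I l (p - q) = word_I l p \<ominus>\<^bsub>U_I l\<^esub> word_I l q"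
  using word_I_add[of p "- q"] by (simp add: words_over_uminus word_I_uminus a_minus_def)

section \<open>The left ideal of C and the module \<open>M_C\<close> in terms of words\<close>

lemma left_ideal_C_eq: "left_ideal_C l = (\<lambda>r. word_I l (r * fgen mat_C)) ` words_over sl2"
  by (auto simp: left_ideal_C_def carrier_U_I word_I_mult \<iota>_def simp flip: word_I_def)

lemma abelian_subgroup_left_ideal_C: "abelian_subgroup (left_ideal_C l) (U_I l)"
proof (rule abelian_subgroupI3[OF additive_subgroupI])
  show "abelian_group (U_I l)" by unfold_locales
  show "subgroup (left_ideal_C l) (add_monoid (U_I l))"
  proof (rule group.subgroupI[OF hom.S.a_group])
    show "left_ideal_C l \<subseteq> carrier (add_monoid (U_I l))"
      by (auto simp: left_ideal_C_eq intro!: word_I_closed)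
    show "left_ideal_C l \<noteq> {}" by (auto simp: left_ideal_C_eq intro: words_over_zero)
  next
    fix a assume "a \<in> left_ideal_C l"
    then obtain r where r: "r \<in> words_over sl2" "a = word_I l (r * fgen mat_C)" by (auto simp: left_ideal_C_eq)
    have "\<ominus>\<^bsub>U_I l\<^esub> a = word_I l (- r * fgen mat_C)" using r by (simp add: words_over_mult flip: word_I_uminus)
    then show "inv\<^bsub>add_monoid (U_I l)\<^esub> a \<in> left_ideal_C l"
      using r(1) unfolding a_inv_def[symmetric] left_ideal_C_eq by blast
  next
    fix a b assume "a \<in> left_ideal_C l" "b \<in> left_ideal_C l"
    then obtain r r' where r: "r \<in> words_over sl2" "a = word_I l (r * fgen mat_C)"
        "r' \<in> words_over sl2" "b = word_I l (r' * fgen mat_C)" by (auto simp: left_ideal_C_eq)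
    have "a \<oplus>\<^bsub>U_I l\<^esub> b = word_I l ((r + r') * fgen mat_C)"
      using r by (simp add: words_over_mult distrib_right flip: word_I_add)
    then show "a \<otimes>\<^bsub>add_monoid (U_I l)\<^esub> b \<in> left_ideal_C l"
      using r(1,3) unfolding left_ideal_C_eq by auto
  qed
qed

interpretation L: abelian_subgroup "left_ideal_C l" "U_I l"
  by (rule abelian_subgroup_left_ideal_C)

definition word_M :: "(complex^2^2) words \<Rightarrow> uea set set" where
  "word_M p = left_ideal_C l +>\<^bsub>U_I l\<^esub> word_I l p"

lemma word_M_eq_iff:
  assumes "p \<in> words_over sl2" "q \<in> words_over sl2"
  shows "word_M p = word_M q \<longleftrightarrow> word_I l (p - q) \<in> left_ideal_C l"
proof -
  have "word_M p = word_M q \<longleftrightarrow> word_I l p \<in> word_M q"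
    unfolding word_M_def
    using L.a_repr_independence'[of "word_I l p" "word_I l q"] L.a_rcos_self[of "word_I l p"]
      word_I_closed[OF assms(1)] word_I_closed[OF assms(2)] by auto
  also have "\<dots> \<longleftrightarrow> word_I l p \<ominus>\<^bsub>U_I l\<^esub> word_I l q \<in> left_ideal_C l"
    unfolding word_M_def using assms by (intro L.a_rcos_module_minus word_I_closed ring_U_I)
  finally show ?thesis using assms by (simp add: word_I_diff)
qed

lemma carrier_M_C: "carrier (M_C l) = word_M ` words_over sl2"
  by (auto simp: M_C_def A_RCOSETS_def' carrier_U_I word_M_def)

lemma zero_M_C: "\<zero>\<^bsub>M_C l\<^esub> = word_M 0"
  by (simp add: M_C_def word_M_def word_I_zero L.a_subset)

lemma add_M_C: "p \<in> words_over sl2 \<Longrightarrow> q \<in> words_over sl2 \<Longrightarrow> word_M p \<oplus>\<^bsub>M_C l\<^esub> word_M q = word_M (p + q)"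
  by (simp add: M_C_def word_M_def word_I_add L.a_rcos_sum word_I_closed)

text \<open>The union in the scalar multiplication runs over equal cosets: another representative
  differs by some \<open>r * fgen mat_C\<close>, and left multiplication by \<open>p\<close> keeps
  this in the left ideal.\<close>

lemma smult_M_C:
  assumes p: "p \<in> words_over sl2" and q: "q \<in> words_over sl2"
  shows "to_U p \<odot>\<^bsub>M_C l\<^esub> word_M q = word_M (p * q)"
proof -
  have *: "left_ideal_C l +>\<^bsub>U_I l\<^esub> (to_U_I l (to_U p) \<otimes>\<^bsub>U_I l\<^esub> v) = word_M (p * q)"
    if "v \<in> word_M q" for v
  proof -
    from that obtain r where r: "r \<in> words_over sl2" "v = word_I l (r * fgen mat_C) \<oplus>\<^bsub>U_I l\<^esub> word_I l q"
      by (auto simp: word_M_def a_r_coset_def' left_ideal_C_eq)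
    have v: "to_U_I l (to_U p) \<otimes>\<^bsub>U_I l\<^esub> v = word_I l (p * (r * fgen mat_C + q))"
      using p q r by (simp add: word_I_mult word_I_add words_over_mult words_over_add flip: word_I_def)
    have "word_M (p * (r * fgen mat_C + q)) = word_M (p * q)"
    proof (subst word_M_eq_iff)
      have "p * (r * fgen mat_C + q) - p * q = (p * r) * fgen mat_C"
        by (simp add: algebra_simps)
      then show "word_I l (p * (r * fgen mat_C + q) - p * q) \<in> left_ideal_C l"
        using p r by (auto simp: left_ideal_C_eq intro!: image_eqI[of _ _ "p * r"])
    qed (use p q r in auto)
    then show ?thesis by (simp add: v word_M_def)
  qed
  \<comment> \<open>A union of equal cosets is that coset only when the index set is
    nonempty.\<close>
  have "word_M q \<noteq> {}"
    using L.a_rcos_self[OF word_I_closed[OF q]] by (auto simp: word_M_def)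
  then show ?thesis
    using * by (auto simp: M_C_def)
qed

end

section \<open>The action on functions on the integers\<close>

text \<open>The coordinates of a traceless matrix in the basis \<open>E\<close>, \<open>F\<close>, \<open>H\<close>.\<close>

definition coef_E :: "complex^2^2 \<Rightarrow> complex" where
  "coef_E A = A $ 1 $ 1 - \<i> / 2 * (A $ 1 $ 2 + A $ 2 $ 1)"

definition coef_F :: "complex^2^2 \<Rightarrow> complex" where
  "coef_F A = A $ 1 $ 1 + \<i> / 2 * (A $ 1 $ 2 + A $ 2 $ 1)"

definition coef_H :: "complex^2^2 \<Rightarrow> complex" where
  "coef_H A = \<i> / 2 * (A $ 1 $ 2 - A $ 2 $ 1)"

lemma coef_add:
  "coef_E (A + B) = coef_E A + coef_E B"
  "coef_F (A + B) = coef_F A + coef_F B"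
  "coef_H (A + B) = coef_H A + coef_H B"
  by (simp_all add: coef_E_def coef_F_def coef_H_def field_simps)

lemma coef_mscale:
  "coef_E (mscale a A) = a * coef_E A"
  "coef_F (mscale a A) = a * coef_F A"
  "coef_H (mscale a A) = a * coef_H A"
  by (simp_all add: coef_E_def coef_F_def coef_H_def mscale_def field_simps)

text \<open>The relations [H,E] = 2E, [H,F] = -2F and [E,F] = H, extended bilinearly to
  coordinates.\<close>

lemma coef_bracket:
  assumes "A \<in> sl2" "B \<in> sl2"
  shows "coef_E (bracket A B) = 2 * (coef_H A * coef_E B - coef_H B * coef_E A)"
    and "coef_F (bracket A B) = 2 * (coef_H B * coef_F A - coef_H A * coef_F B)"
    and "coef_H (bracket A B) = coef_E A * coef_F B - coef_F A * coef_E B"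
  using assms
  by (simp_all add: coef_E_def coef_F_def coef_H_def bracket_def matrix_matrix_mult_def sum_2
      sl2_iff algebra_simps add_divide_distrib diff_divide_distrib)

text \<open>The value at \<open>n\<close> is the coefficient of \<open>v_n\<close> after
  \<open>A\<close> has acted on the sum of the \<open>f m * v_m\<close>: E brings
  \<open>v_(n-1)\<close> to \<open>v_n\<close> with factor \<open>s + n - 1\<close>, and F brings
  \<open>v_(n+1)\<close> there with factor \<open>s - n - 1\<close>. Only three values of
  \<open>f\<close> enter, so the formula makes sense for functions of any support.\<close>

definition rep :: "int \<Rightarrow> complex^2^2 \<Rightarrow> (int \<Rightarrow> complex) \<Rightarrow> int \<Rightarrow> complex" where
  "rep s A f = (\<lambda>n. coef_E A * of_int (s + n - 1) * f (n - 1) +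
     coef_F A * of_int (s - n - 1) * f (n + 1) + coef_H A * of_int (2 * n) * f n)"

lemma linear_map_rep [simp]: "linear_map (rep s A)"
  by (simp add: linear_map_def rep_def algebra_simps)

lemma rep_add: "rep s (A + B) f = (\<lambda>n. rep s A f n + rep s B f n)"
  by (simp add: rep_def coef_add fun_eq_iff algebra_simps)

lemma rep_mscale: "rep s (mscale a A) f = (\<lambda>n. a * rep s A f n)"
  by (simp add: rep_def coef_mscale fun_eq_iff algebra_simps)

text \<open>This makes \<open>rep\<close> a representation of the Lie algebra. With the bracket
  coordinates inserted, it is a polynomial identity in the values of \<open>f\<close> near
  \<open>n\<close>.\<close>

lemma rep_bracket:
  assumes "A \<in> sl2" "B \<in> sl2"
  shows "rep s (bracket A B) f = (\<lambda>n. rep s A (rep s B f) n - rep s B (rep s A f) n)"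
proof
  fix n
  show "rep s (bracket A B) f n = rep s A (rep s B f) n - rep s B (rep s A f) n"
    unfolding rep_def coef_bracket[OF assms] by (simp add: algebra_simps)
qed

lemma coef_mats:
  "coef_E mat_h = 1" "coef_F mat_h = 1" "coef_H mat_h = 0"
  "coef_E mat_x = - \<i> / 2" "coef_F mat_x = \<i> / 2" "coef_H mat_x = \<i> / 2"
  "coef_E mat_y = - \<i> / 2" "coef_F mat_y = \<i> / 2" "coef_H mat_y = - \<i> / 2"
  "coef_E mat_B = - \<i>" "coef_F mat_B = \<i>" "coef_H mat_B = 0"
  "coef_E mat_C = 0" "coef_F mat_C = 0" "coef_H mat_C = \<i>"
  by (simp_all add: coef_E_def coef_F_def coef_H_def)

abbreviation act :: "int \<Rightarrow> (complex^2^2) words \<Rightarrow> (int \<Rightarrow> complex) \<Rightarrow> int \<Rightarrow> complex" where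
  "act s \<equiv> algebra_action (rep s)"

lemma act_mult: "act s (p * q) f = act s p (act s q f)"
  by (simp add: algebra_action_mult)

lemma linear_map_zero: "linear_map T \<Longrightarrow> T (\<lambda>n. 0) = (\<lambda>n. 0)"
  unfolding linear_map_def by (drule conjunct2, drule spec[of _ 0]) simp

lemma linear_map_act [simp]: "linear_map (act s p)"
  by (rule linear_map_action) simp

text \<open>Words acting as zero on every function, not only on \<open>unit_vec 0\<close>; this
  makes the set a two-sided ideal, to which the minimality of generated ideals applies.\<close>

definition annihilator :: "int \<Rightarrow> (complex^2^2) words set" where
  "annihilator s = {p \<in> words_over sl2. \<forall>f. act s p f = (\<lambda>n. 0)}"

lemma ideal_annihilator: "ideal (annihilator s) (free_algebra sl2)"
proof (rule idealI[OF ring_free_algebra])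
  interpret ring "free_algebra sl2" by (rule ring_free_algebra)
  show "subgroup (annihilator s) (add_monoid (free_algebra sl2))"
  proof (rule group.subgroupI[OF a_group])
    fix p assume p: "p \<in> annihilator s"
    have "\<ominus>\<^bsub>free_algebra sl2\<^esub> p = - p"
      using p by (intro minus_equality) (auto simp: annihilator_def)
    then show "inv\<^bsub>add_monoid (free_algebra sl2)\<^esub> p \<in> annihilator s"
      using p unfolding a_inv_def[symmetric] by (simp add: annihilator_def algebra_action_uminus)
  qed (auto simp: annihilator_def algebra_action_add intro!: exI[of _ 0])
qed (auto simp: annihilator_def act_mult linear_map_zero)

section \<open>Descent of the action to the quotients\<close>

lemma uea_ideal_annihilator: "uea_ideal \<subseteq> annihilator s"
proof -
  have "uea_relations \<subseteq> annihilator s"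
  proof
    fix p assume p: "p \<in> uea_relations"
    then have "act s p f = (\<lambda>n. 0)" for f
      unfolding uea_relations_def
      by (auto simp: algebra_action_diff algebra_action_add act_mult rep_add rep_mscale rep_bracket)
    then show "p \<in> annihilator s"
      using p uea_relations_subset by (auto simp: annihilator_def)
  qed
  then show ?thesis
    unfolding uea_ideal_def
    by (intro ring.genideal_minimal[OF ring_free_algebra] ideal_annihilator)
qed

text \<open>The Casimir element acts on the whole function space as the scalar
  \<open>(2 * s - 1)^2\<close>, and the hypothesis identifies this with the scalar in the
  relation.\<close>

lemma casimir_relation_annihilator:
  assumes "(l + 1)\<^sup>2 = (2 * of_int s - 1)\<^sup>2"
  shows "casimir_relation l \<in> annihilator s"
proof -
  \<comment> \<open>In the triple, x = c(E - F - H) and y = c(E - F + H). The common factor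
    satisfies 4c^2 = -1, so 4yx = -(E - F + H)(E - F - H).\<close>
  define c where "c = - \<i> / 2"
  have c: "4 * (c * (c * z)) = - z" for z
    by (simp add: c_def field_simps)
  define X where "X f n = of_int (s + n - 1) * f (n - 1) - of_int (s - n - 1) * f (n + 1) - of_int (2 * n) * f n"
    for f :: "int \<Rightarrow> complex" and n
  define Y where "Y f n = of_int (s + n - 1) * f (n - 1) - of_int (s - n - 1) * f (n + 1) + of_int (2 * n) * f n"
    for f :: "int \<Rightarrow> complex" and n
  define h where "h f n = of_int (s + n - 1) * f (n - 1) + of_int (s - n - 1) * f (n + 1)"
    for f :: "int \<Rightarrow> complex" and n
  have cx: "coef_E mat_x = c" "coef_F mat_x = - c" "coef_H mat_x = - c"
    and cy: "coef_E mat_y = c" "coef_F mat_y = - c" "coef_H mat_y = c"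
    by (simp_all add: coef_mats c_def)
  have lx: "c * a * p + - c * b * q + - c * d * r = c * (a * p - b * q - d * r)"
    and ly: "c * a * p + - c * b * q + c * d * r = c * (a * p - b * q + d * r)" for a b d p q r
    by (simp_all add: algebra_simps)
  have x: "rep s mat_x f = (\<lambda>n. c * X f n)" for f
    unfolding rep_def cx X_def lx ..
  have y: "rep s mat_y f = (\<lambda>n. c * Y f n)" for f
    unfolding rep_def cy Y_def ly ..
  have h: "rep s mat_h f = h f" for f
    by (simp add: rep_def coef_mats h_def fun_eq_iff)
  have YX: "Y (\<lambda>n. c * X f n) n = c * Y (X f) n" for f n
    by (simp add: Y_def algebra_simps)
  have hh: "h (\<lambda>n. h f n + f n) n = h (h f) n + h f n" for f n
    by (simp add: h_def[of _ n] algebra_simps)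
  \<comment> \<open>This is (h + 1)^2 + 4yx with the factor \<open>c\<close> removed. The
    contributions of \<open>f\<close> at distance 1 and 2 from \<open>n\<close> cancel.\<close>
  have id: "h (h f) n + h f n + (h f n + f n) - Y (X f) n = (2 * of_int s - 1)\<^sup>2 * f n" for f n
  proof -
    \<comment> \<open>Naming the five values of \<open>f\<close> and the two integer casts leaves a
      plain polynomial identity.\<close>
    define a b d where "a = f (n - 2)" and "b = f (n + 2)" and "d = f n"
    define u v where "u = f (n - 1)" and "v = f (n + 1)"
    define m t :: complex where "m = of_int n" and "t = of_int s"
    have e: "n - 1 - 1 = n - 2" "n - 1 + 1 = n" "n + 1 - 1 = n" "n + 1 + 1 = n + 2" by auto
    show ?thesis
      unfolding h_def X_def Y_def e of_int_add of_int_diff of_int_mult of_int_1 of_int_numeral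
      unfolding a_def[symmetric] b_def[symmetric] d_def[symmetric] u_def[symmetric] v_def[symmetric]
        m_def[symmetric] t_def[symmetric]
      by (simp add: algebra_simps power2_eq_square)
  qed
  have "act s (casimir_relation l) f n = 0" for f n
  proof -
    have "act s (casimir_relation l) f n = h (h f) n + h f n + (h f n + f n)
        + 4 * (c * (c * Y (X f) n)) - (2 * of_int s - 1)\<^sup>2 * f n"
      unfolding casimir_relation_def assms power2_eq_square[of "fgen mat_h + 1"]
      by (simp add: algebra_action_diff algebra_action_add act_mult x y h YX hh)
    then show ?thesis using id[of f n] by (simp add: c)
  qed
  then show ?thesis by (simp add: annihilator_def words_over_casimir_relation fun_eq_iff)
qed

lemma to_U_eq_iff:
  assumes "p \<in> words_over sl2" "q \<in> words_over sl2"
  shows "to_U p = to_U q \<longleftrightarrow> p - q \<in> uea_ideal"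
proof -
  interpret ring "free_algebra sl2" by (rule ring_free_algebra)
  have "\<ominus>\<^bsub>free_algebra sl2\<^esub> q = - q"
    using assms by (intro minus_equality) auto
  then show ?thesis
    using quotient_eq_iff_same_a_r_cos[OF ideal_uea_ideal, of p q] assms
    by (auto simp: to_U_def a_minus_def)
qed

lemma word_I_eq_zero_iff:
  assumes "p \<in> words_over sl2"
  shows "word_I l p = \<zero>\<^bsub>U_I l\<^esub> \<longleftrightarrow> to_U p \<in> I_ideal l"
proof -
  interpret U: ring U_sl2 by (rule ring_U_sl2)
  interpret I: ideal "I_ideal l" U_sl2 by (rule ideal_I_ideal)
  have "word_I l p = \<zero>\<^bsub>U_I l\<^esub> \<longleftrightarrow> I_ideal l +>\<^bsub>U_sl2\<^esub> to_U p = I_ideal l +>\<^bsub>U_sl2\<^esub> \<zero>\<^bsub>U_sl2\<^esub>"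
    by (simp add: word_I_def to_U_I_def U_I_def FactRing_def I.a_subset)
  also have "\<dots> \<longleftrightarrow> to_U p \<ominus>\<^bsub>U_sl2\<^esub> \<zero>\<^bsub>U_sl2\<^esub> \<in> I_ideal l"
    using U.quotient_eq_iff_same_a_r_cos[OF ideal_I_ideal, of "to_U p" "\<zero>\<^bsub>U_sl2\<^esub>"] assms
    by (simp add: to_U_closed)
  also have "to_U p \<ominus>\<^bsub>U_sl2\<^esub> \<zero>\<^bsub>U_sl2\<^esub> = to_U p"
    using assms by (simp add: a_minus_def to_U_closed)
  finally show ?thesis .
qed

text \<open>Since \<open>I_ideal\<close> lives in \<open>U_sl2\<close>, minimality has to be applied
  to the image of the annihilator. This is an ideal because \<open>to_U\<close> is a homomorphism
  onto \<open>U_sl2\<close>.\<close>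

lemma ideal_to_U_annihilator: "ideal (to_U ` annihilator s) U_sl2"
proof (rule idealI[OF ring_U_sl2])
  interpret U: ring U_sl2 by (rule ring_U_sl2)
  have sub: "p \<in> words_over sl2" if "p \<in> annihilator s" for p
    using that by (simp add: annihilator_def)
  show "subgroup (to_U ` annihilator s) (add_monoid U_sl2)"
  proof (rule group.subgroupI[OF U.a_group])
    show "to_U ` annihilator s \<subseteq> carrier (add_monoid U_sl2)"
      using sub by (auto intro: to_U_closed)
    show "to_U ` annihilator s \<noteq> {}"
    proof -
      have "0 \<in> annihilator s" by (simp add: annihilator_def)
      then show ?thesis by auto
    qed
  next
    fix u assume "u \<in> to_U ` annihilator s"
    then obtain p where p: "p \<in> annihilator s" "u = to_U p" by blast
    have "- p \<in> annihilator s"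
      using p(1) by (simp add: annihilator_def algebra_action_uminus)
    then show "inv\<^bsub>add_monoid U_sl2\<^esub> u \<in> to_U ` annihilator s"
      unfolding a_inv_def[symmetric] p(2) to_U_uminus[OF sub[OF p(1)], symmetric] by (rule imageI)
  next
    fix u v assume "u \<in> to_U ` annihilator s" "v \<in> to_U ` annihilator s"
    then obtain p q where p: "p \<in> annihilator s" "u = to_U p" "q \<in> annihilator s" "v = to_U q" by blast
    then have "p + q \<in> annihilator s"
      by (simp add: annihilator_def algebra_action_add)
    then show "u \<otimes>\<^bsub>add_monoid U_sl2\<^esub> v \<in> to_U ` annihilator s"
      using p(2,4) to_U_add[OF sub[OF p(1)] sub[OF p(3)]] by (metis imageI monoid.simps(1))
  qed
next
  fix u v assume "u \<in> to_U ` annihilator s" "v \<in> carrier U_sl2"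
  then obtain p q where p: "p \<in> annihilator s" "u = to_U p" "q \<in> words_over sl2" "v = to_U q"
    by (auto simp: carrier_U_sl2)
  then have "q * p \<in> annihilator s" "p * q \<in> annihilator s"
    by (auto simp: annihilator_def act_mult linear_map_zero)
  then show "v \<otimes>\<^bsub>U_sl2\<^esub> u \<in> to_U ` annihilator s" "u \<otimes>\<^bsub>U_sl2\<^esub> v \<in> to_U ` annihilator s"
    using p by (auto simp: annihilator_def simp flip: to_U_mult)
qed

definition unit_vec :: "int \<Rightarrow> int \<Rightarrow> complex" where
  "unit_vec m = (\<lambda>n. if n = m then 1 else 0)"

text \<open>By minimality \<open>I_ideal\<close> lies in the image of the annihilator, so
  \<open>p\<close> differs from an annihilating word by an element of \<open>uea_ideal\<close>,
  which acts as zero as well.\<close>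

lemma word_I_zero_annihilator:
  assumes l: "(l + 1)\<^sup>2 = (2 * of_int s - 1)\<^sup>2"
    and p: "p \<in> words_over sl2" and "word_I l p = \<zero>\<^bsub>U_I l\<^esub>"
  shows "p \<in> annihilator s"
proof -
  have "I_ideal l \<subseteq> to_U ` annihilator s"
    unfolding I_ideal_eq using casimir_relation_annihilator[OF l]
    by (intro ring.genideal_minimal[OF ring_U_sl2] ideal_to_U_annihilator) simp
  then obtain q where q: "q \<in> annihilator s" "to_U p = to_U q"
    using assms by (auto simp: word_I_eq_zero_iff)
  then have "p - q \<in> annihilator s"
    using to_U_eq_iff[of p q] p uea_ideal_annihilator[of s] by (auto simp: annihilator_def)
  then show ?thesis
    using q(1) p by (auto simp: annihilator_def algebra_action_diff fun_eq_iff)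
qed

text \<open>C acts on \<open>v_n\<close> as a multiple of \<open>n\<close>, hence kills
  \<open>v_0\<close>. So the action on \<open>v_0\<close> depends only on the class of a word in the
  module, which is the source of linear independence.\<close>

lemma left_ideal_C_annihilates:
  assumes l: "(l + 1)\<^sup>2 = (2 * of_int s - 1)\<^sup>2"
    and p: "p \<in> words_over sl2" and "word_I l p \<in> left_ideal_C l"
  shows "act s p (unit_vec 0) = (\<lambda>n. 0)"
proof -
  obtain r where r: "r \<in> words_over sl2" "word_I l p = word_I l (r * fgen mat_C)"
    using assms(3) by (auto simp: left_ideal_C_eq)
  interpret R: ring "U_I l" by (rule ring_U_I)
  have "word_I l (p - r * fgen mat_C) = \<zero>\<^bsub>U_I l\<^esub>"
    using p r by (simp add: word_I_diff word_I_closed R.r_neg a_minus_def)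
  then have *: "p - r * fgen mat_C \<in> annihilator s"
    using p r by (intro word_I_zero_annihilator[OF l]) auto
  have "rep s mat_C (unit_vec 0) = (\<lambda>n. 0)"
    by (auto simp: rep_def coef_mats unit_vec_def fun_eq_iff)
  then have "act s (r * fgen mat_C) (unit_vec 0) = (\<lambda>n. 0)"
    by (simp add: act_mult linear_map_zero)
  then show ?thesis
    using * by (simp add: annihilator_def algebra_action_diff fun_eq_iff)
qed

section \<open>Relations in the module\<close>

text \<open>The words that represent zero in the module \<open>M_C\<close>. They are stable under
  left multiplication.\<close>

definition null_word :: "complex \<Rightarrow> (complex^2^2) words \<Rightarrow> bool" where
  "null_word l p \<longleftrightarrow> p \<in> words_over sl2 \<and> word_I l p \<in> left_ideal_C l"

lemma null_word_words_over: "null_word l p \<Longrightarrow> p \<in> words_over sl2"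
  by (simp add: null_word_def)

lemma null_word_zero [simp]: "null_word l 0"
  unfolding null_word_def left_ideal_C_eq by (auto intro!: image_eqI[of _ _ 0])

lemma null_word_add: "null_word l p \<Longrightarrow> null_word l q \<Longrightarrow> null_word l (p + q)"
proof -
  assume p: "null_word l p" and q: "null_word l q"
  then obtain r r' where "r \<in> words_over sl2" "word_I l p = word_I l (r * fgen mat_C)"
      "r' \<in> words_over sl2" "word_I l q = word_I l (r' * fgen mat_C)"
    by (auto simp: null_word_def left_ideal_C_eq)
  then show ?thesis
    using p q unfolding null_word_def left_ideal_C_eq
    by (auto simp: word_I_add distrib_right intro!: image_eqI[of _ _ "r + r'"])
qed

lemma null_word_mult: "p \<in> words_over sl2 \<Longrightarrow> null_word l q \<Longrightarrow> null_word l (p * q)"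
proof -
  assume p: "p \<in> words_over sl2" and q: "null_word l q"
  then obtain r where r: "r \<in> words_over sl2" "word_I l q = word_I l (r * fgen mat_C)"
    by (auto simp: null_word_def left_ideal_C_eq)
  then have "word_I l (p * q) = word_I l (p * r * fgen mat_C)"
    using p null_word_words_over[OF q] word_I_mult[of p q] word_I_mult[of p "r * fgen mat_C" l]
    by (simp add: mult.assoc)
  then show ?thesis
    using p q r(1) unfolding null_word_def left_ideal_C_eq
    by (auto intro!: image_eqI[of _ _ "p * r"])
qed

lemma null_word_uminus: "null_word l p \<Longrightarrow> null_word l (- p)"
  using null_word_mult[of "- 1" l p] by simp

lemma null_word_diff: "null_word l p \<Longrightarrow> null_word l q \<Longrightarrow> null_word l (p - q)"
  using null_word_add[of l p "- q"] null_word_uminus[of l q] by simp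

lemma null_word_mat_C: "null_word l (fgen mat_C)"
  unfolding null_word_def left_ideal_C_eq by (auto intro!: image_eqI[of _ _ 1])

text \<open>The words that vanish already in \<open>U_I\<close>. They may be multiplied on both
  sides, so the relations of the algebra are kept in this form until they are applied to a basis
  word.\<close>

definition zero_word :: "complex \<Rightarrow> (complex^2^2) words \<Rightarrow> bool" where
  "zero_word l p \<longleftrightarrow> p \<in> words_over sl2 \<and> word_I l p = \<zero>\<^bsub>U_I l\<^esub>"

context
  fixes l :: complex
begin

interpretation R: ring "U_I l" by (rule ring_U_I)

lemma zero_word_add: "zero_word l p \<Longrightarrow> zero_word l q \<Longrightarrow> zero_word l (p + q)"
  by (simp add: zero_word_def word_I_add)

lemma zero_word_mult_left: "p \<in> words_over sl2 \<Longrightarrow> zero_word l q \<Longrightarrow> zero_word l (p * q)"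
  by (simp add: zero_word_def word_I_mult word_I_closed)

lemma zero_word_mult_right: "zero_word l p \<Longrightarrow> q \<in> words_over sl2 \<Longrightarrow> zero_word l (p * q)"
  by (simp add: zero_word_def word_I_mult word_I_closed)

lemma zero_word_uminus: "zero_word l p \<Longrightarrow> zero_word l (- p)"
  using zero_word_mult_left[of "- 1" p] by simp

lemma zero_word_diff: "zero_word l p \<Longrightarrow> zero_word l q \<Longrightarrow> zero_word l (p - q)"
  unfolding diff_conv_add_uminus by (intro zero_word_add zero_word_uminus)

lemma zero_word_null: "zero_word l p \<Longrightarrow> null_word l p"
  using null_word_zero[of l] by (simp add: zero_word_def null_word_def word_I_zero)

lemma zero_word_relation:
  assumes "r \<in> uea_relations"
  shows "zero_word l r"
proof -
  have r: "r \<in> words_over sl2" using assms uea_relations_subset by blast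
  have "r \<in> uea_ideal"
    using assms(1) ring.genideal_self[OF ring_free_algebra, of uea_relations sl2] uea_relations_subset
    by (auto simp: uea_ideal_def)
  then have "to_U r = to_U 0" using r by (simp add: to_U_eq_iff)
  then have "to_U r \<in> I_ideal l"
    using additive_subgroup.zero_closed[OF ideal.axioms(1)[OF ideal_I_ideal]] by (simp add: to_U_zero)
  then show ?thesis using r by (simp add: word_I_eq_zero_iff zero_word_def)
qed

lemma zero_word_casimir_relation: "zero_word l (casimir_relation l)"
proof -
  have "to_U (casimir_relation l) \<in> I_ideal l"
    unfolding I_ideal_eq
    by (rule ring.genideal_self'[OF ring_U_sl2]) (simp add: to_U_closed words_over_casimir_relation)
  then show ?thesis
    by (simp add: zero_word_def word_I_eq_zero_iff words_over_casimir_relation)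
qed

end

section \<open>The triple E, F, H and its relations\<close>

definition mat_E :: "complex^2^2" where "mat_E = mscale (1 / 2) (mat_h + mscale \<i> mat_B)"
definition mat_F :: "complex^2^2" where "mat_F = mscale (1 / 2) (mat_h + mscale (- \<i>) mat_B)"
definition mat_H :: "complex^2^2" where "mat_H = mscale (- \<i>) mat_C"

lemma ladder_in_sl2 [simp, intro]: "mat_E \<in> sl2" "mat_F \<in> sl2" "mat_H \<in> sl2"
  unfolding mat_E_def mat_F_def mat_H_def by auto

lemma coef_ladder:
  "coef_E mat_E = 1" "coef_F mat_E = 0" "coef_H mat_E = 0"
  "coef_E mat_F = 0" "coef_F mat_F = 1" "coef_H mat_F = 0"
  "coef_E mat_H = 0" "coef_F mat_H = 0" "coef_H mat_H = 1"
  by (simp_all add: mat_E_def mat_F_def mat_H_def coef_add coef_mscale coef_mats)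

text \<open>Three entries are recovered by inverting the coordinate formulas, and the trace
  condition gives the fourth.\<close>

lemma sl2_eqI:
  assumes "A \<in> sl2" "B \<in> sl2" "coef_E A = coef_E B" "coef_F A = coef_F B" "coef_H A = coef_H B"
  shows "A = B"
proof -
  have 1: "A $ 1 $ 1 = (coef_E A + coef_F A) / 2" for A
    by (simp add: coef_E_def coef_F_def)
  have 2: "A $ 1 $ 2 = \<i> / 2 * (coef_E A - coef_F A) - \<i> * coef_H A" for A
    by (simp add: coef_E_def coef_F_def coef_H_def field_simps)
  have 3: "A $ 2 $ 1 = \<i> / 2 * (coef_E A - coef_F A) + \<i> * coef_H A" for A
    by (simp add: coef_E_def coef_F_def coef_H_def field_simps)
  have "A $ 1 $ 1 = B $ 1 $ 1" "A $ 1 $ 2 = B $ 1 $ 2" "A $ 2 $ 1 = B $ 2 $ 1"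
    using assms(3-5) unfolding 1[of A] 2[of A] 3[of A] 1[of B] 2[of B] 3[of B] by simp_all
  then show ?thesis
    using assms(1,2) by (simp add: vec_eq_iff forall_2 sl2_iff)
qed

lemma sl2_decomp:
  assumes "A \<in> sl2"
  shows "A = mscale (coef_E A) mat_E + (mscale (coef_F A) mat_F + mscale (coef_H A) mat_H)"
  by (rule sl2_eqI) (auto simp: assms coef_add coef_mscale coef_ladder)

lemma brackets:
  "bracket mat_H mat_E = mscale 2 mat_E" "bracket mat_H mat_F = mscale (- 2) mat_F"
  "bracket mat_E mat_F = mat_H"
  by (rule sl2_eqI; auto simp: coef_mscale coef_ladder coef_bracket)+

abbreviation "gE \<equiv> fgen mat_E"
abbreviation "gF \<equiv> fgen mat_F"
abbreviation "gH \<equiv> fgen mat_H"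

text \<open>\<open>fgen\<close> is linear only modulo the relations. Two additivity relations and
  three scaling relations telescope to the claim.\<close>

lemma zero_word_decomp:
  assumes "A \<in> sl2"
  shows "zero_word l (fgen A - (fconst (coef_E A) * gE + fconst (coef_F A) * gF + fconst (coef_H A) * gH))"
proof -
  let ?a = "mscale (coef_E A) mat_E" and ?b = "mscale (coef_F A) mat_F" and ?c = "mscale (coef_H A) mat_H"
  have 1: "zero_word l (fgen (?a + (?b + ?c)) - (fgen ?a + fgen (?b + ?c)))"
    by (rule zero_word_relation) (unfold uea_relations_def, blast)
  have 2: "zero_word l (fgen (?b + ?c) - (fgen ?b + fgen ?c))"
    by (rule zero_word_relation) (unfold uea_relations_def, blast)
  have 3: "zero_word l (fgen (mscale a B) - fconst a * fgen B)" if "B \<in> sl2" for a B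
    using that by (intro zero_word_relation) (unfold uea_relations_def, blast)
  have "zero_word l ((fgen (?a + (?b + ?c)) - (fgen ?a + fgen (?b + ?c))) + ((fgen (?b + ?c) - (fgen ?b + fgen ?c)) +
     ((fgen ?a - fconst (coef_E A) * gE) + ((fgen ?b - fconst (coef_F A) * gF) + (fgen ?c - fconst (coef_H A) * gH)))))"
    by (intro zero_word_add 1 2 3) auto
  then show ?thesis
    unfolding sl2_decomp[OF assms, symmetric] by (simp add: algebra_simps)
qed

lemma zero_word_brackets:
  "zero_word l (gH * gE - gE * gH - fconst 2 * gE)"
  "zero_word l (gH * gF - gF * gH + fconst 2 * gF)"
  "zero_word l (gE * gF - gF * gE - gH)"
proof -
  have b: "zero_word l (fgen A * fgen B - fgen B * fgen A - fgen (bracket A B))"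
    if "A \<in> sl2" "B \<in> sl2" for A B
    using that by (intro zero_word_relation) (unfold uea_relations_def, blast)
  have m: "zero_word l (fgen (mscale a B) - fconst a * fgen B)" if "B \<in> sl2" for a B
    using that by (intro zero_word_relation) (unfold uea_relations_def, blast)
  show "zero_word l (gE * gF - gF * gE - gH)"
    using b[of mat_E mat_F] by (simp add: brackets)
  show "zero_word l (gH * gE - gE * gH - fconst 2 * gE)"
    using zero_word_add[OF b[of mat_H mat_E] m[of mat_E 2]] by (simp add: brackets)
  show "zero_word l (gH * gF - gF * gH + fconst 2 * gF)"
    using zero_word_add[OF b[of mat_H mat_F] m[of mat_F "- 2"]] by (simp add: brackets flip: fconst_uminus)
qed

text \<open>The Casimir element has the same form in every such triple. Substituting h = E + F and
  the expressions of x and y by E, F, H leaves a difference that is a combination of the three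
  commutator relations.\<close>

lemma zero_word_casimir_ladder:
  "zero_word l ((gH + 1) * (gH + 1) + fconst 4 * (gF * gE) - fconst ((l + 1)\<^sup>2))"
proof -
  let ?h = "fgen mat_h" and ?x = "fgen mat_x" and ?y = "fgen mat_y"
  define c :: complex where "c = - \<i> / 2"
  define X where "X = fconst c * (gE - gF - gH)"
  define Y where "Y = fconst c * (gE - gF + gH)"
  have words_over: "X \<in> words_over sl2" "Y \<in> words_over sl2" by (auto simp: X_def Y_def)
  have cc: "fconst 4 * (fconst c * (fconst c * z)) = - z" for z :: "(complex^2^2) words"
  proof -
    have "fconst 4 * (fconst c * (fconst c * z)) = fconst (4 * (c * c)) * z"
      by (simp add: fconst_mult mult.assoc flip: mult.assoc[of "fconst _" "fconst _"])
    also have "4 * (c * c) = - 1" by (simp add: c_def)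
    finally show ?thesis by (simp add: fconst_one flip: fconst_uminus)
  qed
  have m: "fconst (- a) = - fconst a" for a
    by (simp add: fconst_uminus)
  have h: "zero_word l (?h - (gE + gF))"
    using zero_word_decomp[of mat_h l] by (simp add: coef_mats fconst_one fconst_zero)
  have x: "zero_word l (?x - X)"
    using zero_word_decomp[of mat_x l]
    by (simp add: m coef_mats X_def c_def algebra_simps)
  have y: "zero_word l (?y - Y)"
    using zero_word_decomp[of mat_y l]
    by (simp add: m coef_mats Y_def c_def algebra_simps)
  have YX: "fconst 4 * (Y * X) = - ((gE - gF + gH) * (gE - gF - gH))"
    unfolding X_def Y_def
    by (simp only: mult.assoc fconst_commute[of "gE - gF + gH"] cc flip: mult.assoc[of "gE - gF + gH"])
  \<comment> \<open>A difference of squares of noncommuting elements: each summand keeps one factor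
    \<open>?h - (gE + gF)\<close>, which is zero in \<open>U_I\<close>.\<close>
  have e1: "(?h + 1) * (?h + 1) - (gE + gF + 1) * (gE + gF + 1)
      = (?h - (gE + gF)) * (?h + 1) + (gE + gF + 1) * (?h - (gE + gF))"
    by (simp add: algebra_simps)
  have 1: "zero_word l ((?h + 1) * (?h + 1) - (gE + gF + 1) * (gE + gF + 1))"
    unfolding e1 by (intro zero_word_add zero_word_mult_left zero_word_mult_right h) auto
  have e2: "?y * ?x - Y * X = (?y - Y) * ?x + Y * (?x - X)"
    by (simp add: algebra_simps)
  have 2: "zero_word l (fconst 4 * (?y * ?x - Y * X))"
    unfolding e2 by (intro zero_word_add zero_word_mult_left zero_word_mult_right x y) (auto simp: words_over)
  have 3: "zero_word l ((?h + 1) * (?h + 1) + fconst 4 * (?y * ?x) - fconst ((l + 1)\<^sup>2))"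
    using zero_word_casimir_relation[of l] unfolding casimir_relation_def power2_eq_square[of "?h + 1"] .
  \<comment> \<open>With 2 and 4 written as repeated sums, the identity below follows from the
    noncommutative ring laws.\<close>
  have t: "fconst 2 * z = z + z" "fconst 4 * z = z + z + (z + z)" for z :: "(complex^2^2) words"
  proof -
    have "(4 :: (complex^2^2) words) = 2 + 2" by simp
    then show "fconst 2 * z = z + z" "fconst 4 * z = z + z + (z + z)"
      by (simp_all only: fconst_numeral distrib_right mult_2)
  qed
  \<comment> \<open>The target is written as the original Casimir relation, corrected by the two
    substitutions and the three commutator relations.\<close>
  have e4: "(gH + 1) * (gH + 1) + fconst 4 * (gF * gE) - fconst ((l + 1)\<^sup>2)
     = ((?h + 1) * (?h + 1) + fconst 4 * (?y * ?x) - fconst ((l + 1)\<^sup>2))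
       - ((?h + 1) * (?h + 1) - (gE + gF + 1) * (gE + gF + 1)) - fconst 4 * (?y * ?x - Y * X)
       + (gH * gE - gE * gH - fconst 2 * gE) - (gH * gF - gF * gH + fconst 2 * gF)
       - fconst 2 * (gE * gF - gF * gE - gH)"
    unfolding right_diff_distrib[of "fconst 4" "?y * ?x"] YX unfolding t
    by (simp add: algebra_simps)
  show ?thesis
    unfolding e4
    by (rule zero_word_diff[OF zero_word_diff[OF zero_word_add[OF zero_word_diff[OF zero_word_diff[OF 3 1] 2]
            zero_word_brackets(1)] zero_word_brackets(2)] zero_word_mult_left[OF words_over_fconst zero_word_brackets(3)]])
qed

section \<open>Ladders of words\<close>

lemma fconst_left_mult: "fconst a * (fconst b * p) = fconst (a * b) * p"
  by (simp add: fconst_mult flip: mult.assoc)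

lemma fconst_left_commute: "p * (fconst a * q) = fconst a * (p * q)"
  by (simp add: fconst_commute flip: mult.assoc)

text \<open>One half of the weight basis, in a form that serves both directions: it is instantiated
  by (E, F, H) and by (F, E, -H).\<close>

locale word_ladder =
  fixes l :: complex and s :: int and E F H :: "(complex^2^2) words"
  assumes s: "s \<ge> 1"
    and words_over_ladder: "E \<in> words_over sl2" "F \<in> words_over sl2" "H \<in> words_over sl2"
    and H_null: "null_word l H"
    and comm: "zero_word l (H * E - E * H - fconst 2 * E)"
    and cas: "zero_word l ((H + 1) * (H + 1) + fconst 4 * (F * E) - fconst ((2 * of_int s - 1)\<^sup>2))"
begin

text \<open>Powers of \<open>E\<close>, scaled so that raising \<open>e n\<close> gives exactly
  \<open>s + n\<close> times the next word. The denominators are nonzero because \<open>s\<close> is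
  positive.\<close>

primrec e :: "nat \<Rightarrow> (complex^2^2) words" where
  "e 0 = 1"
| "e (Suc n) = fconst (1 / (of_int s + of_nat n)) * (E * e n)"

lemma e_words_over [simp]: "e n \<in> words_over sl2"
  by (induction n) (auto simp: words_over_ladder)

lemma denom_nonzero: "of_int s + of_nat n \<noteq> (0 :: complex)"
proof -
  have "of_int s + of_nat n = (of_int (s + int n) :: complex)" by simp
  also have "\<dots> \<noteq> 0" using s by (subst of_int_eq_0_iff) auto
  finally show ?thesis .
qed

lemma E_e: "E * e n = fconst (of_int s + of_nat n) * e (Suc n)"
  using denom_nonzero by (simp add: fconst_left_mult fconst_one)

text \<open>Moving \<open>H\<close> past one factor \<open>E\<close> raises the weight by 2; at the
  start, \<open>H\<close> itself is null.\<close>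

lemma H_e: "null_word l (H * e n - fconst (2 * of_nat n) * e n)"
proof (induction n)
  case 0
  then show ?case by (simp add: H_null fconst_zero)
next
  case (Suc n)
  let ?K = "H * E - E * H - fconst 2 * E" and ?d = "H * e n - fconst (2 * of_nat n) * e n"
    and ?c = "fconst (1 / (of_int s + of_nat n))"
  have "H * e (Suc n) - fconst (2 * of_nat (Suc n)) * e (Suc n)
      = ?c * (H * (E * e n)) - fconst (2 * of_nat (Suc n)) * (?c * (E * e n))"
    by (simp only: e.simps fconst_left_commute[of H])
  also have "fconst (2 * of_nat (Suc n)) * (?c * (E * e n)) = ?c * (fconst (2 * of_nat n + 2) * (E * e n))"
  proof -
    have "2 * of_nat (Suc n) * (1 / (of_int s + of_nat n)) = 1 / (of_int s + of_nat n) * (2 * of_nat n + 2 :: complex)"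
      by simp
    then show ?thesis by (simp only: fconst_left_mult)
  qed
  also have "fconst (2 * of_nat n + 2) * (E * e n) = fconst (2 * of_nat n) * (E * e n) + fconst 2 * (E * e n)"
    by (simp only: fconst_add[symmetric] distrib_right)
  also have "?c * (H * (E * e n)) - ?c * (fconst (2 * of_nat n) * (E * e n) + fconst 2 * (E * e n)) = ?c * (?K * e n + E * ?d)"
    by (simp add: algebra_simps fconst_left_commute[of E])
  \<comment> \<open>The first summand vanishes in \<open>U_I\<close> and may be multiplied on the
    right by \<open>e n\<close>; the second is null by induction, and \<open>E\<close> acts on it
    from the left.\<close>
  finally have eq: "H * e (Suc n) - fconst (2 * of_nat (Suc n)) * e (Suc n) = ?c * (?K * e n + E * ?d)" .
  show ?case
    unfolding eq
    by (rule null_word_mult[OF words_over_fconst null_word_add[OF zero_word_null[OF zero_word_mult_right[OF comm e_words_over]]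
            null_word_mult[OF words_over_ladder(1) Suc]]])
qed

text \<open>On weight \<open>2 * n\<close> the Casimir relation gives \<open>4 * F * E = (2 * s -
  1)^2 - (2 * n + 1)^2 = 4 * (s + n) * (s - n - 1)\<close>. The factor \<open>s + n\<close> cancels
  against the normalisation of \<open>e (Suc n)\<close>.\<close>

lemma F_e: "null_word l (F * e (Suc n) - fconst (of_int s - of_nat n - 1) * e n)"
proof -
  let ?K = "(H + 1) * (H + 1) + fconst 4 * (F * E) - fconst ((2 * of_int s - 1)\<^sup>2)"
  define N :: complex where "N = 2 * of_nat n"
  define S :: complex where "S = of_int s"
  let ?d = "H * e n - fconst N * e n"
  have d: "null_word l ?d" using H_e[of n] by (simp add: N_def)
  \<comment> \<open>The Casimir relation applied to \<open>e n\<close>; the subtracted null words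
    replace \<open>H\<close> by its eigenvalue \<open>N\<close>, first inside the square and then in
    the remaining terms.\<close>
  let ?w = "?K * e n - H * ?d - (fconst N * ?d + (?d + ?d))"
  have w: "null_word l ?w"
    by (rule null_word_diff[OF null_word_diff[OF zero_word_null[OF zero_word_mult_right[OF cas e_words_over]]
            null_word_mult[OF words_over_ladder(3) d]] null_word_add[OF null_word_mult[OF words_over_fconst d] null_word_add[OF d d]]])
  have "?w = fconst 4 * (F * (E * e n)) + (e n + fconst N * e n + fconst N * e n + fconst (N * N) * e n
      - fconst ((2 * S - 1)\<^sup>2) * e n)"
    unfolding S_def[symmetric]
    by (simp add: algebra_simps fconst_left_commute[of H] fconst_left_mult)
  also have "e n + fconst N * e n + fconst N * e n + fconst (N * N) * e n - fconst ((2 * S - 1)\<^sup>2) * e n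
      = fconst (1 + N + N + N * N - (2 * S - 1)\<^sup>2) * e n"
    by (simp only: fconst_add[symmetric] fconst_diff[symmetric] distrib_right left_diff_distrib
        fconst_one mult_1_left)
  finally have w_eq: "?w = fconst 4 * (F * (E * e n)) + fconst (1 + N + N + N * N - (2 * S - 1)\<^sup>2) * e n" .
  have nz: "S + of_nat n \<noteq> 0" using denom_nonzero by (simp add: S_def)
  have c: "1 / (S + of_nat n) / 4 * (1 + N + N + N * N - (2 * S - 1)\<^sup>2) = - (S - of_nat n - 1)"
  proof -
    have "1 + N + N + N * N - (2 * S - 1)\<^sup>2 = 4 * ((S + of_nat n) * (- (S - of_nat n - 1)))"
      by (simp add: N_def algebra_simps power2_eq_square)
    moreover have "1 / a / 4 * (4 * (a * b)) = b" if "a \<noteq> 0" for a b :: complex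
      using that by simp
    ultimately show ?thesis using nz by (simp only:)
  qed
  have d4: "x / 4 * 4 = x" for x :: complex
    by simp
  have "fconst (1 / (S + of_nat n) / 4) * ?w
      = fconst (1 / (S + of_nat n)) * (F * (E * e n)) + fconst (- (S - of_nat n - 1)) * e n"
    unfolding w_eq unfolding distrib_left fconst_left_mult c unfolding d4 ..
  also have "\<dots> = F * e (Suc n) - fconst (S - of_nat n - 1) * e n"
    unfolding fconst_uminus[symmetric] e.simps fconst_left_commute[of F] S_def by simp
  finally show ?thesis
    using null_word_mult[OF words_over_fconst[of "1 / (S + of_nat n) / 4"] w] by (simp add: S_def)
qed

end

section \<open>The weight basis of the module\<close>

definition fin_supp :: "(int \<Rightarrow> complex) \<Rightarrow> bool" where
  "fin_supp f \<longleftrightarrow> finite {n. f n \<noteq> 0}"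

lemma fin_supp_zero [simp]: "fin_supp (\<lambda>n. 0)"
  by (simp add: fin_supp_def)

lemma fin_supp_unit_vec [simp]: "fin_supp (unit_vec m)"
  by (simp add: fin_supp_def unit_vec_def)

lemma fin_supp_add: "fin_supp f \<Longrightarrow> fin_supp g \<Longrightarrow> fin_supp (\<lambda>n. f n + g n)"
  unfolding fin_supp_def by (rule finite_subset[of _ "{n. f n \<noteq> 0} \<union> {n. g n \<noteq> 0}"]) auto

lemma fin_supp_scale: "fin_supp f \<Longrightarrow> fin_supp (\<lambda>n. a * f n)"
  unfolding fin_supp_def by (rule finite_subset[of _ "{n. f n \<noteq> 0}"]) auto

lemma fin_supp_rep: assumes "fin_supp f" shows "fin_supp (rep s A f)"
proof -
  let ?S = "{n. f n \<noteq> 0}"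
  have "{n. rep s A f n \<noteq> 0} \<subseteq> (\<lambda>n. n + 1) ` ?S \<union> (\<lambda>n. n - 1) ` ?S \<union> ?S"
  proof
    fix n assume "n \<in> {n. rep s A f n \<noteq> 0}"
    then have "f (n - 1) \<noteq> 0 \<or> f (n + 1) \<noteq> 0 \<or> f n \<noteq> 0" by (auto simp: rep_def)
    then show "n \<in> (\<lambda>n. n + 1) ` ?S \<union> (\<lambda>n. n - 1) ` ?S \<union> ?S"
      by (auto intro: image_eqI[of _ _ "n - 1"] image_eqI[of _ _ "n + 1"])
  qed
  then show ?thesis
    unfolding fin_supp_def by (rule finite_subset) (use assms in \<open>simp add: fin_supp_def\<close>)
qed

lemma act_fgen_mult: "act s (fgen A * p) f = rep s A (act s p f)"
  by (simp add: act_mult)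

lemma fin_supp_act: "p \<in> words_over sl2 \<Longrightarrow> fin_supp f \<Longrightarrow> fin_supp (act s p f)"
  by (induction p rule: words_over_induct)
    (simp_all add: fin_supp_scale act_fgen_mult fin_supp_rep algebra_action_add fin_supp_add)

lemma fin_supp_induct [consumes 1, case_names zero add]:
  assumes "fin_supp f"
    and "P (\<lambda>n. 0)"
    and add: "\<And>a m f. fin_supp f \<Longrightarrow> P f \<Longrightarrow> P (\<lambda>n. a * unit_vec m n + f n)"
  shows "P f"
proof -
  have "finite S \<Longrightarrow> {n. f n \<noteq> 0} \<subseteq> S \<Longrightarrow> P f" for S
  proof (induction S arbitrary: f rule: finite_induct)
    case empty
    then have "f = (\<lambda>n. 0)" by auto
    then show ?case using assms(2) by simp
  next
    case (insert m S)
    let ?g = "f(m := 0)"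
    have g: "{n. ?g n \<noteq> 0} \<subseteq> S" using insert.prems by auto
    then have "fin_supp ?g" unfolding fin_supp_def using insert.hyps(1) finite_subset by blast
    moreover have "f = (\<lambda>n. f m * unit_vec m n + ?g n)" by (auto simp: unit_vec_def)
    ultimately show ?case using add[of ?g "f m" m] insert.IH[OF g] by simp
  qed
  then show ?thesis using assms(1) by (auto simp: fin_supp_def)
qed

lemma rep_unit_vec:
  "rep s A (unit_vec m) = (\<lambda>n. coef_E A * of_int (s + m) * unit_vec (m + 1) n +
     (coef_F A * of_int (s - m) * unit_vec (m - 1) n + coef_H A * of_int (2 * m) * unit_vec m n))"
  by (auto simp: rep_def unit_vec_def fun_eq_iff)

text \<open>\<open>l\<close> enters \<open>I_ideal\<close> only through \<open>(l + 1)^2\<close>,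
  here the square of the odd number \<open>2 * s - 1\<close>. The integer \<open>s\<close> is the
  index at which the highest and lowest weight obstructions occur.\<close>

locale casimir_module =
  fixes l :: complex and s :: int
  assumes s: "s \<ge> 1" and l: "(l + 1)\<^sup>2 = (2 * of_int s - 1)\<^sup>2"
begin

lemma null_gH: "null_word l gH"
proof -
  have "zero_word l (gH - fconst (- \<i>) * fgen mat_C)"
    unfolding mat_H_def by (rule zero_word_relation) (use mat_in_sl2 in \<open>unfold uea_relations_def, blast\<close>)
  from null_word_add[OF zero_word_null[OF this] null_word_mult[OF words_over_fconst[where a = "- \<i>"] null_word_mat_C]]
  show ?thesis by simp
qed

sublocale up: word_ladder l s gE gF gH
  by unfold_locales
    (use s null_gH zero_word_brackets(1) zero_word_casimir_ladder[of l] in \<open>auto simp: l\<close>)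

text \<open>Exchanging E and F and negating H preserves the relations of the triple, so the lowering
  ladder is another raising ladder.\<close>

sublocale down: word_ladder l s gF gE "- gH"
proof
  have "- gH * gF - gF * - gH - fconst 2 * gF = - (gH * gF - gF * gH + fconst 2 * gF)"
    by (simp add: algebra_simps)
  then show "zero_word l (- gH * gF - gF * - gH - fconst 2 * gF)"
    using zero_word_uminus[OF zero_word_brackets(2)] by simp
  have t: "fconst 4 * z = z + z + (z + z)" for z :: "(complex^2^2) words"
  proof -
    have "(4 :: (complex^2^2) words) = 2 + 2" by simp
    then show ?thesis by (simp only: fconst_numeral distrib_right mult_2)
  qed
  \<comment> \<open>The exchange changes the Casimir expression by four times the relation EF - FE =
    H.\<close>
  have "(- gH + 1) * (- gH + 1) + fconst 4 * (gE * gF) - fconst ((l + 1)\<^sup>2)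
    = ((gH + 1) * (gH + 1) + fconst 4 * (gF * gE) - fconst ((l + 1)\<^sup>2)) + fconst 4 * (gE * gF - gF * gE - gH)"
    unfolding t by (simp add: algebra_simps)
  then show "zero_word l ((- gH + 1) * (- gH + 1) + fconst 4 * (gE * gF) - fconst ((2 * of_int s - 1)\<^sup>2))"
    using zero_word_add[OF zero_word_casimir_ladder zero_word_mult_left[OF words_over_fconst zero_word_brackets(3)], of l 4]
    by (simp only: l)
qed (use s null_word_uminus[OF null_gH] in auto)

text \<open>Both ladders start with the word 1, so they fit together at index 0.\<close>

definition basis :: "int \<Rightarrow> (complex^2^2) words" where
  "basis m = (if m \<ge> 0 then up.e (nat m) else down.e (nat (- m)))"

lemma basis_words_over [simp]: "basis m \<in> words_over sl2"
  by (simp add: basis_def)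

lemma basis_zero: "basis 0 = 1"
  by (simp add: basis_def)

lemma basis_up: "basis (int n) = up.e n"
  by (simp add: basis_def)

lemma basis_down: "basis (- int n) = down.e n"
  by (simp add: basis_def)

text \<open>At a nonnegative index this is the normalisation of the upper ladder. At a negative
  index \<open>gE\<close> is the lowering element of the other ladder, and the Casimir computation
  supplies the coefficient.\<close>

lemma basis_E: "null_word l (gE * basis m - fconst (of_int (s + m)) * basis (m + 1))"
proof (cases "m \<ge> 0")
  case True
  then obtain n where n: "m = int n" by (metis nonneg_int_cases)
  have "basis (m + 1) = up.e (Suc n)" using basis_up[of "Suc n"] by (simp add: n add.commute)
  then show ?thesis
    using up.E_e[of n] by (simp add: n basis_up del: up.e.simps)
next
  case False
  \<comment> \<open>The successor makes \<open>m + 1\<close> the index \<open>-n\<close>, which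
    still lies on the lower ladder, including \<open>n = 0\<close>.\<close>
  then obtain n where n: "m = - int (Suc n)" by (metis int_cases linorder_not_le of_nat_0_le_iff)
  have e: "m + 1 = - int n" by (simp add: n)
  have "of_int (s + m) = (of_int s - of_nat n - 1 :: complex)" by (simp add: n)
  then show ?thesis
    unfolding e unfolding n basis_down using down.F_e[of n] by (simp only: n)
qed

lemma basis_F: "null_word l (gF * basis m - fconst (of_int (s - m)) * basis (m - 1))"
proof (cases "m \<le> 0")
  case True
  then obtain n where n: "m = - int n" by (metis minus_minus neg_0_le_iff_le nonneg_int_cases)
  have "m - 1 = - int (Suc n)" by (simp add: n)
  then have "basis (m - 1) = down.e (Suc n)" by (simp only: basis_down)
  then show ?thesis
    using down.E_e[of n] by (simp add: n basis_down del: down.e.simps)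
next
  case False
  then obtain n where n: "m = int (Suc n)" by (metis int_cases linorder_not_le neg_le_0_iff_le of_nat_0_le_iff not0_implies_Suc of_nat_0)
  have e: "m - 1 = int n" by (simp add: n)
  have "of_int (s - m) = (of_int s - of_nat n - 1 :: complex)" by (simp add: n)
  then show ?thesis
    unfolding e unfolding n basis_up using up.F_e[of n] by (simp only: n)
qed

lemma basis_H: "null_word l (gH * basis m - fconst (of_int (2 * m)) * basis m)"
proof (cases "m \<ge> 0")
  case True
  then obtain n where n: "m = int n" by (metis nonneg_int_cases)
  then show ?thesis
    using up.H_e[of n] by (simp add: n basis_up)
next
  case False
  then obtain n where n: "m = - int n" by (metis int_cases linorder_not_le of_nat_0_le_iff)
  show ?thesis
    using null_word_uminus[OF down.H_e[of n]] by (simp add: n basis_down add.commute flip: fconst_uminus)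
qed

text \<open>Linearity in \<open>A\<close> combines the three ladder formulas; the coefficients are
  those of \<open>rep_unit_vec\<close>.\<close>

lemma basis_gen:
  assumes "A \<in> sl2"
  shows "null_word l (fgen A * basis m -
    (fconst (coef_E A * of_int (s + m)) * basis (m + 1) + (fconst (coef_F A * of_int (s - m)) * basis (m - 1)
      + fconst (coef_H A * of_int (2 * m)) * basis m)))"
proof -
  let ?d = "fgen A - (fconst (coef_E A) * gE + fconst (coef_F A) * gF + fconst (coef_H A) * gH)"
  have "null_word l (?d * basis m
      + (fconst (coef_E A) * (gE * basis m - fconst (of_int (s + m)) * basis (m + 1))
      + (fconst (coef_F A) * (gF * basis m - fconst (of_int (s - m)) * basis (m - 1))
      + fconst (coef_H A) * (gH * basis m - fconst (of_int (2 * m)) * basis m))))"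
    by (intro null_word_add zero_word_null[OF zero_word_mult_right[OF zero_word_decomp[OF assms] basis_words_over]]
        null_word_mult[OF words_over_fconst] basis_E basis_F basis_H)
  then show ?thesis
    by (simp add: algebra_simps fconst_left_mult[symmetric] del: of_int_add of_int_diff of_int_mult)
qed

text \<open>The word with prescribed coordinates, meant for finite support; for infinite support the
  sum is 0 by convention.\<close>

definition combo :: "(int \<Rightarrow> complex) \<Rightarrow> (complex^2^2) words" where
  "combo f = (\<Sum>n | f n \<noteq> 0. fconst (f n) * basis n)"

lemma combo_superset:
  assumes "finite S" "{n. f n \<noteq> 0} \<subseteq> S"
  shows "combo f = (\<Sum>n\<in>S. fconst (f n) * basis n)"
  unfolding combo_def using assms
  by (intro sum.mono_neutral_left) (auto simp: fconst_zero)

lemma combo_words_over [simp]: "combo f \<in> words_over sl2"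
  by (auto simp: combo_def)

lemma combo_zero [simp]: "combo (\<lambda>n. 0) = 0"
  by (simp add: combo_def)

lemma combo_unit_vec: "combo (\<lambda>n. a * unit_vec m n) = fconst a * basis m"
  by (subst combo_superset[of "{m}"]) (auto simp: unit_vec_def)

lemma combo_add:
  assumes "fin_supp f" "fin_supp g"
  shows "combo (\<lambda>n. f n + g n) = combo f + combo g"
proof -
  let ?S = "{n. f n \<noteq> 0} \<union> {n. g n \<noteq> 0}"
  have S: "finite ?S" using assms by (simp add: fin_supp_def)
  have "combo (\<lambda>n. f n + g n) = (\<Sum>n\<in>?S. fconst (f n + g n) * basis n)"
    by (rule combo_superset[OF S]) auto
  also have "\<dots> = (\<Sum>n\<in>?S. fconst (f n) * basis n) + (\<Sum>n\<in>?S. fconst (g n) * basis n)"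
    by (simp add: distrib_right sum.distrib flip: fconst_add)
  also have "\<dots> = combo f + combo g"
    by (subst (1 2) combo_superset[OF S]) auto
  finally show ?thesis .
qed

lemma combo_scale: "combo (\<lambda>n. a * f n) = fconst a * combo f"
proof (cases "a = 0")
  case False
  then show ?thesis by (simp add: combo_def sum_distrib_left fconst_left_mult)
qed (simp add: fconst_zero)

text \<open>\<open>combo\<close> intertwines \<open>rep\<close> with left multiplication modulo null
  words. By linearity it is enough to know this on basis words.\<close>

lemma combo_gen:
  assumes A: "A \<in> sl2" and "fin_supp f"
  shows "null_word l (fgen A * combo f - combo (rep s A f))"
  using assms(2)
proof (induction f rule: fin_supp_induct)
  case zero
  then show ?case by (simp add: linear_map_zero)
next
  case (add a m f)
  have rep: "rep s A (\<lambda>n. a * unit_vec m n + f n) = (\<lambda>n. a * rep s A (unit_vec m) n + rep s A f n)"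
    using linear_map_rep[of s A] by (simp add: linear_map_def)
  have unit: "combo (rep s A (unit_vec m)) =
      fconst (coef_E A * of_int (s + m)) * basis (m + 1) + (fconst (coef_F A * of_int (s - m)) * basis (m - 1)
      + fconst (coef_H A * of_int (2 * m)) * basis m)"
    unfolding rep_unit_vec
    by (simp add: combo_add combo_unit_vec fin_supp_add fin_supp_scale
        del: of_int_add of_int_diff of_int_mult)
  have "fgen A * combo (\<lambda>n. a * unit_vec m n + f n) - combo (rep s A (\<lambda>n. a * unit_vec m n + f n)) =
      fconst a * (fgen A * basis m - combo (rep s A (unit_vec m))) + (fgen A * combo f - combo (rep s A f))"
    unfolding rep using add.hyps
    by (simp add: combo_add fin_supp_scale fin_supp_rep combo_scale[of a "rep s A (unit_vec m)"] combo_unit_vec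
        algebra_simps fconst_left_commute[of "fgen A"])
  then show ?case
    using null_word_add[OF null_word_mult[OF words_over_fconst basis_gen[OF A]] add.IH, of a m]
    by (simp only: unit)
qed

text \<open>The basis words span the module: each letter on the left is absorbed into the
  coordinates by \<open>combo_gen\<close>.\<close>

lemma combo_act: "p \<in> words_over sl2 \<Longrightarrow> null_word l (p - combo (act s p (unit_vec 0)))"
proof (induction p rule: words_over_induct)
  case (const a)
  show ?case by (simp add: combo_unit_vec basis_zero)
next
  case (gen A p)
  from null_word_add[OF null_word_mult[OF words_over_fgen[OF gen.hyps(1)] gen.IH]
      combo_gen[OF gen.hyps(1) fin_supp_act[OF gen.hyps(2) fin_supp_unit_vec[of 0], of s]]]
  show ?case by (simp add: act_fgen_mult algebra_simps)
next
  case (add p q)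
  have "combo (act s (p + q) (unit_vec 0)) = combo (act s p (unit_vec 0)) + combo (act s q (unit_vec 0))"
    using add.hyps by (simp add: algebra_action_add combo_add fin_supp_act)
  then show ?case
    using null_word_add[OF add.IH] by (simp add: algebra_simps)
qed

text \<open>One direction is that the action on \<open>v_0\<close> is well defined on the module,
  the other that the basis words span. Together they identify the module with the space of finitely
  supported functions.\<close>

lemma null_word_iff:
  assumes "p \<in> words_over sl2"
  shows "null_word l p \<longleftrightarrow> act s p (unit_vec 0) = (\<lambda>n. 0)"
proof
  assume "null_word l p"
  then show "act s p (unit_vec 0) = (\<lambda>n. 0)"
    using left_ideal_C_annihilates[OF l] by (simp add: null_word_def)
next
  assume "act s p (unit_vec 0) = (\<lambda>n. 0)"
  then show "null_word l p"
    using combo_act[OF assms] by simp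
qed

end

section \<open>Submodules\<close>

context casimir_module
begin

text \<open>The submodules in coordinates: subspaces of the finitely supported functions that are
  stable under \<open>rep\<close>.\<close>

definition invariant :: "(int \<Rightarrow> complex) set \<Rightarrow> bool" where
  "invariant S \<longleftrightarrow> S \<subseteq> Collect fin_supp \<and> (\<lambda>n. 0) \<in> S \<and>
     (\<forall>f\<in>S. \<forall>g\<in>S. (\<lambda>n. f n + g n) \<in> S) \<and> (\<forall>f\<in>S. \<forall>a. (\<lambda>n. a * f n) \<in> S) \<and>
     (\<forall>f\<in>S. \<forall>A\<in>sl2. rep s A f \<in> S)"

lemma invariantD:
  assumes "invariant S"
  shows "f \<in> S \<Longrightarrow> fin_supp f" "(\<lambda>n. 0) \<in> S" "f \<in> S \<Longrightarrow> g \<in> S \<Longrightarrow> (\<lambda>n. f n + g n) \<in> S"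
    "f \<in> S \<Longrightarrow> (\<lambda>n. a * f n) \<in> S" "f \<in> S \<Longrightarrow> A \<in> sl2 \<Longrightarrow> rep s A f \<in> S"
  using assms by (auto simp: invariant_def)

lemma invariant_act:
  assumes S: "invariant S" and f: "f \<in> S" and "p \<in> words_over sl2"
  shows "act s p f \<in> S"
  using assms(3)
  by (induction p rule: words_over_induct)
    (simp_all add: f algebra_action_add act_fgen_mult invariantD(3-5)[OF S])

lemma invariant_span:
  assumes S: "invariant S" and f: "fin_supp f" and "\<And>m. f m \<noteq> 0 \<Longrightarrow> unit_vec m \<in> S"
  shows "f \<in> S"
proof -
  have "finite T \<Longrightarrow> {n. f n \<noteq> 0} \<subseteq> T \<Longrightarrow> (\<And>m. f m \<noteq> 0 \<Longrightarrow> unit_vec m \<in> S) \<Longrightarrow> f \<in> S" for T f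
  proof (induction T arbitrary: f rule: finite_induct)
    case empty
    then have "f = (\<lambda>n. 0)" by auto
    then show ?case using invariantD(2)[OF S] by simp
  next
    case (insert m T)
    have g: "f(m := 0) \<in> S"
    proof (rule insert.IH)
      show "{n. (f(m := 0)) n \<noteq> 0} \<subseteq> T" using insert.prems(1) by auto
      show "unit_vec k \<in> S" if "(f(m := 0)) k \<noteq> 0" for k
        using that by (intro insert.prems(2)) (simp split: if_splits)
    qed
    have f: "(\<lambda>n. f m * unit_vec m n + (f(m := 0)) n) = f" by (auto simp: unit_vec_def)
    have "(\<lambda>n. f m * unit_vec m n) \<in> S"
    proof (cases "f m = 0")
      case True
      then show ?thesis using invariantD(2)[OF S] by simp
    next
      case False
      then show ?thesis by (intro invariantD(4)[OF S] insert.prems(2))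
    qed
    from invariantD(3)[OF S this g] show ?case unfolding f .
  qed
  then show ?thesis using f assms(3) unfolding fin_supp_def by blast
qed

text \<open>The eigenvalues \<open>2 * n\<close> of H are pairwise distinct, so the other points of
  the finite support can be removed one by one.\<close>

lemma invariant_weight:
  assumes S: "invariant S" and f: "f \<in> S" "f m \<noteq> 0"
  shows "unit_vec m \<in> S"
proof -
  have "finite T \<Longrightarrow> {n. f n \<noteq> 0} \<subseteq> insert m T \<Longrightarrow> f \<in> S \<Longrightarrow> f m \<noteq> 0 \<Longrightarrow> unit_vec m \<in> S" for T f
  proof (induction T arbitrary: f rule: finite_induct)
    case empty
    then have u: "unit_vec m = (\<lambda>n. 1 / f m * f n)" by (auto simp: unit_vec_def fun_eq_iff)
    show ?case unfolding u by (rule invariantD(4)[OF S empty.prems(2)])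
  next
    case (insert k T)
    show ?case
    proof (cases "k = m")
      case True
      then show ?thesis using insert by auto
    next
      case False
      \<comment> \<open>\<open>H - 2k\<close> kills the weight \<open>k\<close> and keeps the support otherwise.\<close>
      let ?g = "\<lambda>n. rep s mat_H f n + (- of_int (2 * k)) * f n"
      have g: "?g n = of_int (2 * (n - k)) * f n" for n
        by (simp add: rep_def coef_ladder algebra_simps)
      have "?g \<in> S" using insert.prems(2) by (intro invariantD(3-5)[OF S]) auto
      moreover have "{n. ?g n \<noteq> 0} \<subseteq> insert m T" using insert.prems(1) unfolding g by auto
      moreover have "?g m \<noteq> 0" using False insert.prems(3) unfolding g by simp
      ultimately show ?thesis using insert.IH[of ?g] by blast
    qed
  qed
  then show ?thesis using f invariantD(1)[OF S f(1)] unfolding fin_supp_def by blast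
qed

text \<open>The coefficient of E at \<open>m\<close> is \<open>s + m\<close>, so going up is
  obstructed only at \<open>-s\<close>; symmetrically, going down is obstructed only at
  \<open>s\<close>.\<close>

lemma invariant_up:
  assumes S: "invariant S" and m: "unit_vec m \<in> S" "s + m \<noteq> 0"
  shows "unit_vec (m + 1) \<in> S"
proof (rule invariant_weight[OF S])
  show "rep s mat_E (unit_vec m) \<in> S" using m(1) by (intro invariantD(5)[OF S]) auto
  have "of_int (s + m) \<noteq> (0 :: complex)" using m(2) by (subst of_int_eq_0_iff)
  then show "rep s mat_E (unit_vec m) (m + 1) \<noteq> 0"
    unfolding rep_unit_vec by (simp add: coef_ladder unit_vec_def)
qed

lemma invariant_down:
  assumes S: "invariant S" and m: "unit_vec m \<in> S" "s - m \<noteq> 0"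
  shows "unit_vec (m - 1) \<in> S"
proof (rule invariant_weight[OF S])
  show "rep s mat_F (unit_vec m) \<in> S" using m(1) by (intro invariantD(5)[OF S]) auto
  have "of_int (s - m) \<noteq> (0 :: complex)" using m(2) by (subst of_int_eq_0_iff)
  then show "rep s mat_F (unit_vec m) (m - 1) \<noteq> 0"
    unfolding rep_unit_vec by (simp add: coef_ladder unit_vec_def)
qed

lemma invariant_reach_up:
  assumes "invariant S" "unit_vec m \<in> S" "m \<le> k" "\<And>j. m \<le> j \<Longrightarrow> j < k \<Longrightarrow> s + j \<noteq> 0"
  shows "unit_vec k \<in> S"
  using assms(3,4)
proof (induction k rule: int_ge_induct)
  case base
  then show ?case using assms(2) by simp
next
  case (step k)
  then show ?case by (intro invariant_up[OF assms(1)]) auto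
qed

lemma invariant_reach_down:
  assumes "invariant S" "unit_vec m \<in> S" "k \<le> m" "\<And>j. k < j \<Longrightarrow> j \<le> m \<Longrightarrow> s - j \<noteq> 0"
  shows "unit_vec k \<in> S"
  using assms(3,4)
proof (induction k rule: int_le_induct)
  case base
  then show ?case using assms(2) by simp
next
  case (step k)
  then show ?case by (intro invariant_down[OF assms(1)]) auto
qed

text \<open>Since \<open>s\<close> is positive, the way up from 0 does not meet \<open>-s\<close>
  and the way down does not meet \<open>s\<close>.\<close>

lemma generated_by_unit:
  assumes S: "invariant S" and u: "unit_vec 0 \<in> S" and f: "fin_supp f"
  shows "f \<in> S"
proof (rule invariant_span[OF S f])
  show "unit_vec k \<in> S" for k
  proof (cases "k \<ge> 0")
    case True
    then show ?thesis using s by (intro invariant_reach_up[OF S u]) auto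
  next
    case False
    then show ?thesis using s by (intro invariant_reach_down[OF S u]) auto
  qed
qed

section \<open>Subspaces spanned by weight vectors\<close>

definition supported :: "int set \<Rightarrow> (int \<Rightarrow> complex) set" where
  "supported T = {f. fin_supp f \<and> (\<forall>n. n \<notin> T \<longrightarrow> f n = 0)}"

lemma supported_UNIV: "supported UNIV = Collect fin_supp"
  by (auto simp: supported_def)

text \<open>The hypotheses say that \<open>T\<close> can be left only where the corresponding ladder
  coefficient vanishes.\<close>

lemma invariant_supported:
  assumes up: "\<And>n. n \<in> T \<Longrightarrow> s + n \<noteq> 0 \<Longrightarrow> n + 1 \<in> T"
    and down: "\<And>n. n \<in> T \<Longrightarrow> s - n \<noteq> 0 \<Longrightarrow> n - 1 \<in> T"
  shows "invariant (supported T)"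
proof -
  have "rep s A f n = 0" if f: "f \<in> supported T" and n: "n \<notin> T" for f A n
  proof -
    have f0: "k \<notin> T \<Longrightarrow> f k = 0" for k using f by (simp add: supported_def)
    have "n - 1 + 1 = n" "n + 1 - 1 = n" "s + (n - 1) = s + n - 1" "s - (n + 1) = s - n - 1" by auto
    \<comment> \<open>If a neighbour of \<open>n\<close> lies in \<open>T\<close> although
      \<open>n\<close> does not, the move from it to \<open>n\<close> must be obstructed, so its
      coefficient is 0.\<close>
    then have "f (n - 1) = 0 \<or> s + n - 1 = 0" "f (n + 1) = 0 \<or> s - n - 1 = 0" "f n = 0"
      using up[of "n - 1"] down[of "n + 1"] n f0 by metis+
    then have "of_int (s + n - 1) * f (n - 1) = 0" "of_int (s - n - 1) * f (n + 1) = 0" "f n = 0"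
      by (metis mult_eq_0_iff of_int_0)+
    then show ?thesis by (simp only: rep_def mult.assoc mult_zero_right add_0_right)
  qed
  then show ?thesis
    unfolding invariant_def
    by (simp add: supported_def fin_supp_add fin_supp_scale fin_supp_rep subset_iff)
qed

lemma supported_subset:
  "invariant S \<Longrightarrow> (\<And>m. m \<in> T \<Longrightarrow> unit_vec m \<in> S) \<Longrightarrow> supported T \<subseteq> S"
  by (auto simp: supported_def intro: invariant_span)

abbreviation "T_P \<equiv> {s..}"
abbreviation "T_Q \<equiv> {..- s}"

lemma invariant_PQN:
  "invariant (supported T_P)" "invariant (supported T_Q)" "invariant (supported (T_P \<union> T_Q))"
  "invariant (supported UNIV)"
  by (rule invariant_supported; use s in auto)+

text \<open>A nonzero invariant subspace contains some \<open>v_m\<close> with \<open>m\<close> at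
  least \<open>s\<close>. The way down reaches \<open>v_s\<close> before the obstruction, and from
  there the way up is free.\<close>

lemma supported_P_minimal:
  assumes S: "invariant S" "S \<subseteq> supported T_P" "S \<noteq> {\<lambda>n. 0}"
  shows "S = supported T_P"
proof -
  obtain f where "f \<in> S" "f \<noteq> (\<lambda>n. 0)" using S(3) invariantD(2)[OF S(1)] by blast
  then obtain m where m: "f \<in> S" "f m \<noteq> 0" by auto
  then have m': "unit_vec m \<in> S" "m \<ge> s"
    using invariant_weight[OF S(1)] S(2) by (auto simp: supported_def)
  have u: "unit_vec s \<in> S" using m' by (intro invariant_reach_down[OF S(1) m'(1)]) auto
  have "unit_vec k \<in> S" if "k \<in> T_P" for k
    using that s by (intro invariant_reach_up[OF S(1) u]) auto
  then show ?thesis using supported_subset[OF S(1)] S(2) by blast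
qed

lemma supported_Q_minimal:
  assumes S: "invariant S" "S \<subseteq> supported T_Q" "S \<noteq> {\<lambda>n. 0}"
  shows "S = supported T_Q"
proof -
  obtain f where "f \<in> S" "f \<noteq> (\<lambda>n. 0)" using S(3) invariantD(2)[OF S(1)] by blast
  then obtain m where m: "f \<in> S" "f m \<noteq> 0" by auto
  then have m': "unit_vec m \<in> S" "m \<le> - s"
    using invariant_weight[OF S(1)] S(2) by (auto simp: supported_def)
  have u: "unit_vec (- s) \<in> S" using m' by (intro invariant_reach_up[OF S(1) m'(1)]) auto
  have "unit_vec k \<in> S" if "k \<in> T_Q" for k
    using that s by (intro invariant_reach_down[OF S(1) u]) auto
  then show ?thesis using supported_subset[OF S(1)] S(2) by blast
qed

text \<open>Such a subspace contains some \<open>v_m\<close> with \<open>m\<close> strictly between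
  \<open>-s\<close> and \<open>s\<close>, from which both directions are free.\<close>

lemma supported_N_maximal:
  assumes S: "invariant S" "\<not> S \<subseteq> supported (T_P \<union> T_Q)"
  shows "S = supported UNIV"
proof -
  obtain f m where f: "f \<in> S" "f m \<noteq> 0" "m \<notin> T_P \<union> T_Q"
    using S invariantD(1)[OF S(1)] by (auto simp: supported_def)
  then have m: "unit_vec m \<in> S" "- s < m" "m < s"
    using invariant_weight[OF S(1)] by auto
  have "unit_vec k \<in> S" for k
  proof (cases "k \<ge> m")
    case True
    then show ?thesis using m by (intro invariant_reach_up[OF S(1) m(1)]) auto
  next
    case False
    then show ?thesis using m by (intro invariant_reach_down[OF S(1) m(1)]) auto
  qed
  then show ?thesis
    using supported_subset[OF S(1), of UNIV] invariantD(1)[OF S(1)] by (auto simp: supported_UNIV)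
qed

end

section \<open>Coordinates on the module\<close>

context casimir_module
begin

lemma word_M_eq_iff_act:
  assumes "p \<in> words_over sl2" "q \<in> words_over sl2"
  shows "word_M l p = word_M l q \<longleftrightarrow> act s p (unit_vec 0) = act s q (unit_vec 0)"
proof -
  have "word_M l p = word_M l q \<longleftrightarrow> null_word l (p - q)"
    using assms by (simp add: word_M_eq_iff null_word_def)
  also have "\<dots> \<longleftrightarrow> act s p (unit_vec 0) = act s q (unit_vec 0)"
    using assms by (simp add: null_word_iff algebra_action_diff fun_eq_iff)
  finally show ?thesis .
qed

text \<open>Any representing word yields the same coordinates by \<open>word_M_eq_iff_act\<close>,
  so the choice is harmless.\<close>

definition coords :: "uea set set \<Rightarrow> int \<Rightarrow> complex" where
  "coords v = act s (SOME p. p \<in> words_over sl2 \<and> word_M l p = v) (unit_vec 0)"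

lemma coords_word_M:
  assumes "p \<in> words_over sl2"
  shows "coords (word_M l p) = act s p (unit_vec 0)"
proof -
  have "\<exists>q. q \<in> words_over sl2 \<and> word_M l q = word_M l p" using assms by blast
  note q = someI_ex[OF this]
  show ?thesis
    unfolding coords_def word_M_eq_iff_act[OF conjunct1[OF q] assms, symmetric] by (rule conjunct2[OF q])
qed

lemma in_carrier_M_C: "v \<in> carrier (M_C l) \<longleftrightarrow> (\<exists>p\<in>words_over sl2. v = word_M l p)"
  by (auto simp: carrier_M_C)

text \<open>This turns equations in the module into pointwise equations; the module laws are proved
  through it.\<close>

lemma coords_inject: "v \<in> carrier (M_C l) \<Longrightarrow> w \<in> carrier (M_C l) \<Longrightarrow> coords v = coords w \<longleftrightarrow> v = w"
  unfolding in_carrier_M_C by (elim bexE) (simp add: coords_word_M word_M_eq_iff_act)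

lemma fin_supp_coords: "v \<in> carrier (M_C l) \<Longrightarrow> fin_supp (coords v)"
  unfolding in_carrier_M_C by (elim bexE) (simp add: coords_word_M fin_supp_act)

lemma add_M_C_closed: "v \<in> carrier (M_C l) \<Longrightarrow> w \<in> carrier (M_C l) \<Longrightarrow> v \<oplus>\<^bsub>M_C l\<^esub> w \<in> carrier (M_C l)"
  unfolding in_carrier_M_C using add_M_C words_over_add by metis

lemma coords_add:
  "v \<in> carrier (M_C l) \<Longrightarrow> w \<in> carrier (M_C l) \<Longrightarrow> coords (v \<oplus>\<^bsub>M_C l\<^esub> w) = (\<lambda>n. coords v n + coords w n)"
  unfolding in_carrier_M_C by (elim bexE) (simp add: add_M_C coords_word_M algebra_action_add)

lemma zero_M_C_closed: "\<zero>\<^bsub>M_C l\<^esub> \<in> carrier (M_C l)"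
  unfolding in_carrier_M_C zero_M_C by blast

lemma coords_zero: "coords \<zero>\<^bsub>M_C l\<^esub> = (\<lambda>n. 0)"
  by (simp add: zero_M_C coords_word_M)

lemma smult_M_C_closed: "p \<in> words_over sl2 \<Longrightarrow> v \<in> carrier (M_C l) \<Longrightarrow> to_U p \<odot>\<^bsub>M_C l\<^esub> v \<in> carrier (M_C l)"
  unfolding in_carrier_M_C using smult_M_C words_over_mult by metis

lemma coords_smult: "p \<in> words_over sl2 \<Longrightarrow> v \<in> carrier (M_C l) \<Longrightarrow> coords (to_U p \<odot>\<^bsub>M_C l\<^esub> v) = act s p (coords v)"
  unfolding in_carrier_M_C by (elim bexE) (simp add: smult_M_C coords_word_M act_mult)

text \<open>The image of \<open>coords\<close> is invariant and contains \<open>v_0\<close>, the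
  coordinates of the generator, hence it is everything.\<close>

lemma coords_surj:
  assumes "fin_supp f"
  obtains v where "v \<in> carrier (M_C l)" "coords v = f"
proof -
  let ?S = "coords ` carrier (M_C l)"
  have S: "invariant ?S"
    unfolding invariant_def
  proof (intro conjI ballI allI)
    show "?S \<subseteq> Collect fin_supp" using fin_supp_coords by auto
    show "(\<lambda>n. 0) \<in> ?S"
      unfolding coords_zero[symmetric] by (rule imageI[OF zero_M_C_closed])
  next
    fix f g assume "f \<in> ?S" "g \<in> ?S"
    then obtain v w where v: "v \<in> carrier (M_C l)" "f = coords v" and w: "w \<in> carrier (M_C l)" "g = coords w"
      by blast
    show "(\<lambda>n. f n + g n) \<in> ?S"
      unfolding v(2) w(2) coords_add[OF v(1) w(1), symmetric] by (rule imageI[OF add_M_C_closed[OF v(1) w(1)]])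
  next
    fix f a assume "f \<in> ?S"
    then obtain v where v: "v \<in> carrier (M_C l)" "f = coords v" by blast
    from imageI[OF smult_M_C_closed[OF words_over_fconst v(1)], of coords a] show "(\<lambda>n. a * f n) \<in> ?S"
      by (simp add: coords_smult v)
  next
    fix f A assume "f \<in> ?S" and A: "A \<in> sl2"
    then obtain v where v: "v \<in> carrier (M_C l)" "f = coords v" by blast
    from imageI[OF smult_M_C_closed[OF words_over_fgen[OF A] v(1)], of coords] show "rep s A f \<in> ?S"
      by (simp add: coords_smult v A)
  qed
  have "word_M l 1 \<in> carrier (M_C l)"
    unfolding in_carrier_M_C by blast
  from imageI[OF this, of coords] have u: "unit_vec 0 \<in> ?S" by (simp add: coords_word_M)
  have "f \<in> ?S" by (rule generated_by_unit[OF S u assms])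
  then show thesis using that by blast
qed

definition sub :: "(int \<Rightarrow> complex) set \<Rightarrow> uea set set set" where
  "sub S = {v \<in> carrier (M_C l). coords v \<in> S}"

lemma sub_carrier: "sub (supported UNIV) = carrier (M_C l)"
  by (auto simp: sub_def supported_UNIV fin_supp_coords)

lemma sub_mono_iff:
  assumes "invariant S"
  shows "sub S \<subseteq> sub T \<longleftrightarrow> S \<subseteq> T"
proof
  show "S \<subseteq> T" if "sub S \<subseteq> sub T"
  proof
    fix f assume f: "f \<in> S"
    obtain v where "v \<in> carrier (M_C l)" "coords v = f"
      using coords_surj[OF invariantD(1)[OF assms f]] by blast
    then show "f \<in> T" using f that by (auto simp: sub_def)
  qed
qed (auto simp: sub_def)

lemma neg_M_C:
  assumes "v \<in> carrier (M_C l)"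
  shows "to_U (fconst (- 1)) \<odot>\<^bsub>M_C l\<^esub> v \<oplus>\<^bsub>M_C l\<^esub> v = \<zero>\<^bsub>M_C l\<^esub>"
  using assms
  by (subst coords_inject[symmetric])
    (simp_all add: smult_M_C_closed add_M_C_closed zero_M_C_closed coords_add coords_smult coords_zero)

lemma left_module_sub:
  assumes S: "invariant S"
  shows "left_module U_sl2 (M_C l\<lparr>carrier := sub S\<rparr>)"
proof -
  have sub: "v \<in> carrier (M_C l)" if "v \<in> sub S" for v using that by (simp add: sub_def)
  have add: "v \<oplus>\<^bsub>M_C l\<^esub> w \<in> sub S" if "v \<in> sub S" "w \<in> sub S" for v w
    using that invariantD(3)[OF S] by (simp add: sub_def add_M_C_closed coords_add)
  have smult: "to_U p \<odot>\<^bsub>M_C l\<^esub> v \<in> sub S" if "p \<in> words_over sl2" "v \<in> sub S" for p v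
    using that invariant_act[OF S] by (simp add: sub_def smult_M_C_closed coords_smult)
  have grp: "abelian_group (M_C l\<lparr>carrier := sub S\<rparr>)"
  proof (rule abelian_groupI)
    show "\<zero>\<^bsub>M_C l\<lparr>carrier := sub S\<rparr>\<^esub> \<in> carrier (M_C l\<lparr>carrier := sub S\<rparr>)"
      using invariantD(2)[OF S] by (simp add: sub_def zero_M_C_closed coords_zero)
  next
    fix v assume "v \<in> carrier (M_C l\<lparr>carrier := sub S\<rparr>)"
    then have v: "v \<in> sub S" by simp
    have "to_U (fconst (- 1)) \<odot>\<^bsub>M_C l\<^esub> v \<in> sub S" by (intro smult v) auto
    then show "\<exists>w\<in>carrier (M_C l\<lparr>carrier := sub S\<rparr>). w \<oplus>\<^bsub>M_C l\<lparr>carrier := sub S\<rparr>\<^esub> v = \<zero>\<^bsub>M_C l\<lparr>carrier := sub S\<rparr>\<^esub>"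
      using neg_M_C[OF sub[OF v]] by auto
  next
    fix u v w assume "u \<in> carrier (M_C l\<lparr>carrier := sub S\<rparr>)" "v \<in> carrier (M_C l\<lparr>carrier := sub S\<rparr>)" "w \<in> carrier (M_C l\<lparr>carrier := sub S\<rparr>)"
    then have c: "u \<in> carrier (M_C l)" "v \<in> carrier (M_C l)" "w \<in> carrier (M_C l)" by (auto dest: sub)
    then show "u \<oplus>\<^bsub>M_C l\<lparr>carrier := sub S\<rparr>\<^esub> v \<oplus>\<^bsub>M_C l\<lparr>carrier := sub S\<rparr>\<^esub> w =
        u \<oplus>\<^bsub>M_C l\<lparr>carrier := sub S\<rparr>\<^esub> (v \<oplus>\<^bsub>M_C l\<lparr>carrier := sub S\<rparr>\<^esub> w)"
      by (simp add: coords_inject[symmetric] add_M_C_closed coords_add add.assoc)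
  next
    fix u v assume "u \<in> carrier (M_C l\<lparr>carrier := sub S\<rparr>)" "v \<in> carrier (M_C l\<lparr>carrier := sub S\<rparr>)"
    then have c: "u \<in> carrier (M_C l)" "v \<in> carrier (M_C l)" by (auto dest: sub)
    then show "u \<oplus>\<^bsub>M_C l\<lparr>carrier := sub S\<rparr>\<^esub> v = v \<oplus>\<^bsub>M_C l\<lparr>carrier := sub S\<rparr>\<^esub> u"
      by (simp add: coords_inject[symmetric] add_M_C_closed coords_add add.commute)
  next
    fix v assume "v \<in> carrier (M_C l\<lparr>carrier := sub S\<rparr>)"
    then have c: "v \<in> carrier (M_C l)" by (auto dest: sub)
    then show "\<zero>\<^bsub>M_C l\<lparr>carrier := sub S\<rparr>\<^esub> \<oplus>\<^bsub>M_C l\<lparr>carrier := sub S\<rparr>\<^esub> v = v"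
      by (simp add: coords_inject[symmetric] add_M_C_closed zero_M_C_closed coords_add coords_zero)
  qed (simp add: add)
  have lin: "act s p (\<lambda>n. f n + g n) = (\<lambda>n. act s p f n + act s p g n)" for p f g
    using linear_map_act[of s p] by (simp add: linear_map_def)
  have l_distr: "(to_U p \<oplus>\<^bsub>U_sl2\<^esub> to_U q) \<odot>\<^bsub>M_C l\<^esub> v = to_U p \<odot>\<^bsub>M_C l\<^esub> v \<oplus>\<^bsub>M_C l\<^esub> to_U q \<odot>\<^bsub>M_C l\<^esub> v"
    and assoc: "(to_U p \<otimes>\<^bsub>U_sl2\<^esub> to_U q) \<odot>\<^bsub>M_C l\<^esub> v = to_U p \<odot>\<^bsub>M_C l\<^esub> (to_U q \<odot>\<^bsub>M_C l\<^esub> v)"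
    if "p \<in> words_over sl2" "q \<in> words_over sl2" "v \<in> sub S" for p q v
    using that(1,2) sub[OF that(3)]
    by (simp_all add: coords_inject[symmetric] smult_M_C_closed add_M_C_closed coords_add coords_smult
        algebra_action_add act_mult flip: to_U_add to_U_mult)
  have r_distr: "to_U p \<odot>\<^bsub>M_C l\<^esub> (v \<oplus>\<^bsub>M_C l\<^esub> w) = to_U p \<odot>\<^bsub>M_C l\<^esub> v \<oplus>\<^bsub>M_C l\<^esub> to_U p \<odot>\<^bsub>M_C l\<^esub> w"
    if "p \<in> words_over sl2" "v \<in> sub S" "w \<in> sub S" for p v w
    using that(1) sub[OF that(2)] sub[OF that(3)]
    by (simp add: coords_inject[symmetric] smult_M_C_closed add_M_C_closed coords_add coords_smult lin)
  have one: "\<one>\<^bsub>U_sl2\<^esub> \<odot>\<^bsub>M_C l\<^esub> v = v" if "v \<in> sub S" for v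
    using sub[OF that] by (simp add: coords_inject[symmetric] smult_M_C_closed coords_smult flip: to_U_one)
  show ?thesis
    by (intro left_module.intro ring_U_sl2 grp left_module_axioms.intro)
      (auto simp: carrier_U_sl2 smult add l_distr r_distr assoc one)
qed

end

section \<open>Correspondence between submodules and invariant subspaces\<close>

context casimir_module
begin

lemma sub_UNIV: "M_C l\<lparr>carrier := sub (supported UNIV)\<rparr> = M_C l"
  by (simp add: sub_carrier)

lemma abelian_group_sub: "invariant S \<Longrightarrow> abelian_group (M_C l\<lparr>carrier := sub S\<rparr>)"
  using left_module_sub by (simp add: left_module_def)

text \<open>The ambient \<open>T\<close> covers both the whole module, with
  \<open>T = supported UNIV\<close>, and the summands with restricted carrier. Additive inverses
  come from the scalar -1.\<close>

lemma submodule_sub: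
  assumes S: "invariant S" and T: "invariant T" and "S \<subseteq> T"
  shows "submodule (sub S) U_sl2 (M_C l\<lparr>carrier := sub T\<rparr>)"
proof -
  let ?M = "M_C l\<lparr>carrier := sub T\<rparr>"
  interpret T: abelian_group ?M by (rule abelian_group_sub[OF T])
  interpret S: left_module U_sl2 "M_C l\<lparr>carrier := sub S\<rparr>" by (rule left_module_sub[OF S])
  have sub: "v \<in> carrier (M_C l)" "v \<in> sub T" if "v \<in> sub S" for v
    using that assms(3) by (auto simp: sub_def)
  show ?thesis
  proof (intro submodule.intro subgroup.intro submodule_axioms.intro)
    show "sub S \<subseteq> carrier (add_monoid ?M)"
      using sub by auto
    show "v \<otimes>\<^bsub>add_monoid ?M\<^esub> w \<in> sub S" if "v \<in> sub S" "w \<in> sub S" for v w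
      using S.M.a_closed[of v w] that by simp
    show "\<one>\<^bsub>add_monoid ?M\<^esub> \<in> sub S"
      using S.M.zero_closed by simp
    show "u \<odot>\<^bsub>?M\<^esub> v \<in> sub S" if "u \<in> carrier U_sl2" "v \<in> sub S" for u v
      using S.smult_closed[of u v] that by simp
    show "inv\<^bsub>add_monoid ?M\<^esub> v \<in> sub S" if v: "v \<in> sub S" for v
    proof -
      have w: "to_U (fconst (- 1)) \<odot>\<^bsub>M_C l\<^esub> v \<in> sub S"
        using S.smult_closed[of "to_U (fconst (- 1))" v] v by (simp add: to_U_closed)
      have "\<ominus>\<^bsub>?M\<^esub> v = to_U (fconst (- 1)) \<odot>\<^bsub>M_C l\<^esub> v"
        using neg_M_C[OF sub(1)[OF v]] sub(2)[OF v] sub(2)[OF w] by (intro T.minus_equality) auto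
      then show ?thesis using w by (simp add: a_inv_def)
    qed
  qed
qed

text \<open>The subspace is the image of \<open>W\<close> under \<open>coords\<close>. Constant
  words give its closure under scalars and one-letter words its closure under \<open>rep\<close>;
  injectivity of \<open>coords\<close> recovers \<open>W\<close>.\<close>

lemma submodule_imp_sub:
  assumes "invariant T" and "submodule W U_sl2 (M_C l\<lparr>carrier := sub T\<rparr>)"
  obtains S where "invariant S" "S \<subseteq> T" "W = sub S"
proof -
  let ?M = "M_C l\<lparr>carrier := sub T\<rparr>"
  interpret W: submodule W U_sl2 ?M by fact
  have W: "W \<subseteq> sub T" using W.subset by simp
  then have c: "v \<in> carrier (M_C l)" if "v \<in> W" for v using that by (auto simp: sub_def)
  have zero: "\<zero>\<^bsub>M_C l\<^esub> \<in> W" using W.one_closed by simp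
  have add: "v \<oplus>\<^bsub>M_C l\<^esub> w \<in> W" if "v \<in> W" "w \<in> W" for v w using W.m_closed[of v w] that by simp
  have smult: "to_U p \<odot>\<^bsub>M_C l\<^esub> v \<in> W" if "p \<in> words_over sl2" "v \<in> W" for p v
    using W.smult_closed[of "to_U p" v] that by (simp add: to_U_closed)
  have "invariant (coords ` W)"
    unfolding invariant_def
  proof (intro conjI ballI allI)
    show "coords ` W \<subseteq> Collect fin_supp" using fin_supp_coords c by auto
    show "(\<lambda>n. 0) \<in> coords ` W"
      unfolding coords_zero[symmetric] by (rule imageI[OF zero])
  next
    fix f g assume "f \<in> coords ` W" "g \<in> coords ` W"
    then obtain v w where v: "v \<in> W" "f = coords v" and w: "w \<in> W" "g = coords w" by blast
    show "(\<lambda>n. f n + g n) \<in> coords ` W"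
      unfolding v(2) w(2) coords_add[OF c[OF v(1)] c[OF w(1)], symmetric] by (rule imageI[OF add[OF v(1) w(1)]])
  next
    fix f a assume "f \<in> coords ` W"
    then obtain v where v: "v \<in> W" "f = coords v" by blast
    from imageI[OF smult[OF words_over_fconst v(1)], of coords a] show "(\<lambda>n. a * f n) \<in> coords ` W"
      by (simp add: coords_smult v c)
  next
    fix f A assume "f \<in> coords ` W" and A: "A \<in> sl2"
    then obtain v where v: "v \<in> W" "f = coords v" by blast
    from imageI[OF smult[OF words_over_fgen[OF A] v(1)], of coords] show "rep s A f \<in> coords ` W"
      by (simp add: coords_smult v c A)
  qed
  moreover have "coords ` W \<subseteq> T" using W by (auto simp: sub_def)
  moreover have "W = sub (coords ` W)"
  proof
    show "sub (coords ` W) \<subseteq> W"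
    proof
      fix v assume "v \<in> sub (coords ` W)"
      then obtain w where "v \<in> carrier (M_C l)" "w \<in> W" "coords v = coords w" by (auto simp: sub_def)
      then show "v \<in> W" using coords_inject[of v w] c[of w] by simp
    qed
  qed (auto simp: sub_def c)
  ultimately show thesis by (rule that)
qed

lemma sub_singleton_zero: "sub {\<lambda>n. 0} = {\<zero>\<^bsub>M_C l\<^esub>}"
proof -
  have "coords v = (\<lambda>n. 0) \<longleftrightarrow> v = \<zero>\<^bsub>M_C l\<^esub>" if "v \<in> carrier (M_C l)" for v
    using coords_inject[OF that zero_M_C_closed] by (simp add: coords_zero)
  then show ?thesis using zero_M_C_closed by (auto simp: sub_def)
qed

lemma unit_vec_nonzero: "unit_vec m \<noteq> (\<lambda>n. 0)"
  by (auto simp: unit_vec_def fun_eq_iff intro!: exI[of _ m])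

text \<open>The vector \<open>unit_vec m\<close> witnesses that the module is nonzero; the
  correspondence transports minimality.\<close>

lemma simple_module_sub:
  assumes S: "invariant S" and u: "unit_vec m \<in> S"
    and min: "\<And>T. invariant T \<Longrightarrow> T \<subseteq> S \<Longrightarrow> T \<noteq> {\<lambda>n. 0} \<Longrightarrow> T = S"
  shows "simple_module U_sl2 (M_C l\<lparr>carrier := sub S\<rparr>)"
  unfolding simple_module_def
proof (intro conjI allI impI left_module_sub S)
  have "\<not> sub S \<subseteq> sub {\<lambda>n. 0}"
    unfolding sub_mono_iff[OF S] using u unit_vec_nonzero by auto
  then show "carrier (M_C l\<lparr>carrier := sub S\<rparr>) \<noteq> {\<zero>\<^bsub>M_C l\<lparr>carrier := sub S\<rparr>\<^esub>}"
    by (auto simp: sub_singleton_zero)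
next
  fix W assume "submodule W U_sl2 (M_C l\<lparr>carrier := sub S\<rparr>)"
  then obtain T where T: "invariant T" "T \<subseteq> S" "W = sub T" by (rule submodule_imp_sub[OF S])
  show "W = {\<zero>\<^bsub>M_C l\<lparr>carrier := sub S\<rparr>\<^esub>} \<or> W = carrier (M_C l\<lparr>carrier := sub S\<rparr>)"
    using min[OF T(1,2)] sub_singleton_zero T(3) by (cases "T = {\<lambda>n. 0}") simp_all
qed

lemma simple_PQ:
  "simple_module U_sl2 (M_C l\<lparr>carrier := sub (supported T_P)\<rparr>)"
  "simple_module U_sl2 (M_C l\<lparr>carrier := sub (supported T_Q)\<rparr>)"
  by (rule simple_module_sub[of _ s] simple_module_sub[of _ "- s"], rule invariant_PQN,
      simp add: supported_def unit_vec_def fin_supp_def,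
      rule supported_P_minimal supported_Q_minimal; assumption)+

lemma maximal_submodule_iff:
  "maximal_submodule W U_sl2 (M_C l) \<longleftrightarrow> W = sub (supported (T_P \<union> T_Q))"
proof -
  let ?N = "sub (supported (T_P \<union> T_Q))"
  have sm: "submodule W U_sl2 (M_C l) \<longleftrightarrow> (\<exists>S. invariant S \<and> W = sub S)" for W
  proof
    assume "submodule W U_sl2 (M_C l)"
    then show "\<exists>S. invariant S \<and> W = sub S"
      using submodule_imp_sub[OF invariant_PQN(4), of W] unfolding sub_UNIV by blast
  next
    assume "\<exists>S. invariant S \<and> W = sub S"
    then obtain S where S: "invariant S" "W = sub S" by blast
    then have "S \<subseteq> supported UNIV" using invariantD(1) by (auto simp: supported_UNIV)
    from submodule_sub[OF S(1) invariant_PQN(4) this] show "submodule W U_sl2 (M_C l)"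
      by (simp add: sub_UNIV S)
  qed
  \<comment> \<open>This dichotomy gives both the maximality of \<open>?N\<close> and its
    uniqueness.\<close>
  have big: "W \<subseteq> ?N \<or> W = carrier (M_C l)" if W: "submodule W U_sl2 (M_C l)" for W
  proof -
    obtain S where S: "invariant S" "W = sub S" using W sm by blast
    show ?thesis
      using supported_N_maximal[OF S(1)] sub_mono_iff[OF S(1)] S(2) sub_carrier by auto
  qed
  have N: "submodule ?N U_sl2 (M_C l)" using sm invariant_PQN(3) by blast
  \<comment> \<open>Properness is seen on \<open>v_0\<close>, whose index lies strictly between
    \<open>-s\<close> and \<open>s\<close>.\<close>
  have "\<not> sub (supported UNIV) \<subseteq> ?N"
    unfolding sub_mono_iff[OF invariant_PQN(4)]
  proof
    assume "supported UNIV \<subseteq> supported (T_P \<union> T_Q)"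
    then have "unit_vec 0 \<in> supported (T_P \<union> T_Q)" by (auto simp: supported_UNIV)
    then have "0 \<notin> T_P \<union> T_Q \<Longrightarrow> unit_vec 0 0 = 0" unfolding supported_def by blast
    then show False using s by (simp add: unit_vec_def)
  qed
  then have ne: "?N \<noteq> carrier (M_C l)" by (auto simp: sub_carrier)
  show ?thesis
  proof
    assume "W = ?N"
    then show "maximal_submodule W U_sl2 (M_C l)"
      using N ne big unfolding maximal_submodule_def by blast
  next
    assume "maximal_submodule W U_sl2 (M_C l)"
    then show "W = ?N"
      using N ne big unfolding maximal_submodule_def by blast
  qed
qed

lemma direct_sum_PQ:
  "internal_direct_sum (M_C l) (sub (supported (T_P \<union> T_Q))) (sub (supported T_P)) (sub (supported T_Q))"
  unfolding internal_direct_sum_def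
proof
  show "sub (supported T_P) \<inter> sub (supported T_Q) = {\<zero>\<^bsub>M_C l\<^esub>}"
  proof -
    have "f = (\<lambda>n. 0)" if "f \<in> supported T_P" "f \<in> supported T_Q" for f
    proof
      fix n
      have "n \<notin> T_P \<or> n \<notin> T_Q" using s by auto
      then show "f n = 0" using that by (auto simp: supported_def)
    qed
    then have "supported T_P \<inter> supported T_Q = {\<lambda>n. 0}"
      by (auto simp: supported_def)
    then show ?thesis
      unfolding sub_singleton_zero[symmetric] by (auto simp: sub_def)
  qed
  show "sub (supported (T_P \<union> T_Q)) = sub (supported T_P) <+>\<^bsub>M_C l\<^esub> sub (supported T_Q)"
  proof
    show "sub (supported (T_P \<union> T_Q)) \<subseteq> sub (supported T_P) <+>\<^bsub>M_C l\<^esub> sub (supported T_Q)"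
    proof
      fix v assume v: "v \<in> sub (supported (T_P \<union> T_Q))"
      \<comment> \<open>The coordinates are cut at \<open>s\<close>. Since \<open>v\<close> has none
        strictly between \<open>-s\<close> and \<open>s\<close>, the second piece is supported on
        \<open>T_Q\<close>.\<close>
      define f g where "f = (\<lambda>n. if n \<ge> s then coords v n else 0)" and "g = (\<lambda>n. if n \<ge> s then 0 else coords v n)"
      have fs: "finite {n. coords v n \<noteq> 0}" using v by (simp add: sub_def supported_def fin_supp_def)
      have fg': "{n. f n \<noteq> 0} \<subseteq> {n. coords v n \<noteq> 0}" "{n. g n \<noteq> 0} \<subseteq> {n. coords v n \<noteq> 0}"
        by (auto simp: f_def g_def)
      have fg: "fin_supp f" "fin_supp g"
        unfolding fin_supp_def by (rule finite_subset[OF fg'(1) fs] finite_subset[OF fg'(2) fs])+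
      have f: "f \<in> supported T_P"
        using fg by (simp add: supported_def f_def)
      have g: "g \<in> supported T_Q"
        using fg v by (simp add: sub_def supported_def g_def)
      obtain a b where a: "a \<in> carrier (M_C l)" "coords a = f" and b: "b \<in> carrier (M_C l)" "coords b = g"
        using fg coords_surj by metis
      have "coords v = coords (a \<oplus>\<^bsub>M_C l\<^esub> b)"
        by (auto simp: coords_add a b f_def g_def)
      then have "v = a \<oplus>\<^bsub>M_C l\<^esub> b"
        using v a b by (subst (asm) coords_inject) (auto simp: sub_def add_M_C_closed)
      then show "v \<in> sub (supported T_P) <+>\<^bsub>M_C l\<^esub> sub (supported T_Q)"
        using a b f g by (auto simp: set_add_def' sub_def)
    qed
    show "sub (supported T_P) <+>\<^bsub>M_C l\<^esub> sub (supported T_Q) \<subseteq> sub (supported (T_P \<union> T_Q))"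
      by (auto simp: set_add_def' sub_def add_M_C_closed coords_add supported_def fin_supp_add)
  qed
qed

end

section \<open>Rank\<close>

lemma algebra_action_sum:
  "algebra_action r (sum p I) f = (\<lambda>n. \<Sum>i\<in>I. algebra_action r (p i) f n)"
  by (induction I rule: infinite_finite_induct) (simp_all add: algebra_action_add)

definition word_h :: "complex poly \<Rightarrow> (complex^2^2) words" where
  "word_h p = (\<Sum>i\<le>Polynomial.degree p. fconst (poly.coeff p i) * fgen mat_h ^ i)"

lemma word_h_words_over [simp]: "word_h p \<in> words_over sl2"
  by (auto simp: word_h_def)

lemma poly_h_eq: "poly_h p = to_U (word_h p)"
proof -
  interpret U: ring U_sl2 by (rule ring_U_sl2)
  have "to_U (\<Sum>i\<in>I. f i) = (\<Oplus>\<^bsub>U_sl2\<^esub>i\<in>I. to_U (f i))"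
    if "finite I" "\<And>i. i \<in> I \<Longrightarrow> f i \<in> words_over sl2" for f and I :: "nat set"
    using that
    by (induction I rule: finite_induct) (simp_all add: to_U_zero to_U_add to_U_closed)
  then have "to_U (word_h p) = (\<Oplus>\<^bsub>U_sl2\<^esub>i\<in>{..Polynomial.degree p}. to_U (fconst (poly.coeff p i) * fgen mat_h ^ i))"
    unfolding word_h_def by auto
  also have "\<dots> = poly_h p"
    unfolding poly_h_def const_U_def \<iota>_def
    by (intro U.finsum_cong') (auto simp: to_U_mult to_U_power to_U_closed)
  finally show ?thesis ..
qed

lemma rep_mat_h: "rep s mat_h f = (\<lambda>n. of_int (s + n - 1) * f (n - 1) + of_int (s - n - 1) * f (n + 1))"
  by (simp add: rep_def coef_mats)

definition h_pow :: "int \<Rightarrow> nat \<Rightarrow> int \<Rightarrow> int \<Rightarrow> complex" where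
  "h_pow s i m = act s (fgen mat_h ^ i) (unit_vec m)"

lemma h_pow_0: "h_pow s 0 m = unit_vec m"
  by (simp add: h_pow_def)

lemma h_pow_Suc: "h_pow s (Suc i) m = rep s mat_h (h_pow s i m)"
  by (simp add: h_pow_def act_fgen_mult)

lemma act_word_h:
  assumes "Polynomial.degree p \<le> N"
  shows "act s (word_h p) (unit_vec m) = (\<lambda>n. \<Sum>i\<le>N. poly.coeff p i * h_pow s i m n)"
proof
  fix n
  have "act s (word_h p) (unit_vec m) n = (\<Sum>i\<le>Polynomial.degree p. poly.coeff p i * h_pow s i m n)"
    by (simp add: word_h_def algebra_action_sum act_mult h_pow_def)
  also have "\<dots> = (\<Sum>i\<le>N. poly.coeff p i * h_pow s i m n)"
    using assms by (intro sum.mono_neutral_left) (auto simp: not_le coeff_eq_0)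
  finally show "act s (word_h p) (unit_vec m) n = (\<Sum>i\<le>N. poly.coeff p i * h_pow s i m n)" .
qed

lemma act_word_h_add:
  "act s (word_h (p + q)) (unit_vec m) = (\<lambda>n. act s (word_h p) (unit_vec m) n + act s (word_h q) (unit_vec m) n)"
proof -
  let ?N = "max (Polynomial.degree p) (Polynomial.degree q)"
  have "Polynomial.degree (p + q) \<le> ?N" by (rule degree_add_le_max)
  then show ?thesis
    by (simp add: act_word_h[of _ ?N] distrib_right sum.distrib)
qed

lemma act_word_h_diff:
  "act s (word_h (p - q)) (unit_vec m) = (\<lambda>n. act s (word_h p) (unit_vec m) n - act s (word_h q) (unit_vec m) n)"
  using act_word_h_add[of s "p - q" q m] by (simp add: fun_eq_iff)

lemma act_word_h_monom: "act s (word_h (monom c k)) (unit_vec m) = (\<lambda>n. c * h_pow s k m n)"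
  by (subst act_word_h[of _ k]) (auto simp: degree_monom_le fun_eq_iff if_distrib if_distribR sum.delta' cong: if_cong)

text \<open>Along the sequence \<open>g\<close>, the operator \<open>h\<close> is a Jacobi matrix with nonzero entries below the diagonal.\<close>

locale h_chain = casimir_module +
  fixes g :: "nat \<Rightarrow> int" and S :: "(int \<Rightarrow> complex) set" and \<alpha> \<beta> :: "nat \<Rightarrow> complex"
  assumes g: "inj g" and S_def: "S = supported (range g)" and S: "invariant S"
    and chain: "\<And>f i. f \<in> S \<Longrightarrow> rep s mat_h f (g (Suc i)) = \<alpha> i * f (g i) + \<beta> i * f (g (Suc (Suc i)))"
    and \<alpha>: "\<And>i. \<alpha> i \<noteq> 0"
begin

lemma start: "unit_vec (g 0) \<in> S"
  by (simp add: S_def supported_def) (auto simp: unit_vec_def)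

lemma h_pow_in: "h_pow s i (g 0) \<in> S"
  unfolding h_pow_def by (rule invariant_act[OF S start]) auto

text \<open>Each application of \<open>h\<close> advances by at most one place along
  \<open>g\<close>, so the vectors \<open>h^i v\<close> form a triangular system.\<close>

lemma h_pow_above: "i < j \<Longrightarrow> h_pow s i (g 0) (g j) = 0"
proof (induction i arbitrary: j)
  case 0
  then show ?case using injD[OF g, of j 0] by (auto simp: h_pow_0 unit_vec_def)
next
  case (Suc i)
  then obtain k where "j = Suc k" "i < k" by (cases j) auto
  then show ?case using Suc.IH[of k] Suc.IH[of "Suc (Suc k)"] by (simp add: h_pow_Suc chain[OF h_pow_in])
qed

text \<open>The diagonal entry picks up the factor \<open>\<alpha> i\<close> at each step, since the
  other contribution lies above the diagonal.\<close>

lemma h_pow_diag: "h_pow s i (g 0) (g i) \<noteq> 0"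
proof (induction i)
  case 0
  then show ?case by (simp add: h_pow_0 unit_vec_def)
next
  case (Suc i)
  then show ?case using \<alpha> h_pow_above[of i "Suc (Suc i)"] by (simp add: h_pow_Suc chain[OF h_pow_in])
qed

text \<open>At the place given by the degree of \<open>p - q\<close>, only its leading term
  contributes, and the diagonal entry is nonzero.\<close>

lemma act_word_h_inject:
  assumes "act s (word_h p) (unit_vec (g 0)) = act s (word_h q) (unit_vec (g 0))"
  shows "p = q"
proof (rule ccontr)
  assume "p \<noteq> q"
  then have nz: "lead_coeff (p - q) \<noteq> 0" by (metis leading_coeff_neq_0 right_minus_eq)
  let ?N = "Polynomial.degree (p - q)"
  have "0 = act s (word_h (p - q)) (unit_vec (g 0)) (g ?N)"
    using assms by (simp add: act_word_h_diff)
  also have "\<dots> = (\<Sum>i\<le>?N. poly.coeff (p - q) i * h_pow s i (g 0) (g ?N))"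
    by (simp add: act_word_h[of _ ?N])
  also have "\<dots> = (\<Sum>i\<in>{?N}. poly.coeff (p - q) i * h_pow s i (g 0) (g ?N))"
    by (intro sum.mono_neutral_right) (auto simp: h_pow_above)
  finally show False using nz h_pow_diag[of ?N] by simp
qed

text \<open>Triangular elimination: the top coordinate is removed by a multiple of
  \<open>h^n v\<close>, which lowers the bound on the support along \<open>g\<close>.\<close>

lemma act_word_h_surj_aux:
  "f \<in> S \<Longrightarrow> (\<And>j. j \<ge> n \<Longrightarrow> f (g j) = 0) \<Longrightarrow> \<exists>p. act s (word_h p) (unit_vec (g 0)) = f"
proof (induction n arbitrary: f)
  case 0
  have "f m = 0" for m
    using 0 by (cases "m \<in> range g") (auto simp: S_def supported_def)
  then have "f = (\<lambda>n. 0)" by auto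
  then show ?case using act_word_h_monom[of s 0 0 "g 0"] by auto
next
  case (Suc n)
  define c where "c = f (g n) / h_pow s n (g 0) (g n)"
  let ?f = "\<lambda>m. f m + (- c) * h_pow s n (g 0) m"
  have "?f \<in> S" by (intro invariantD(3,4)[OF S] Suc.prems h_pow_in)
  moreover have "?f (g j) = 0" if "j \<ge> n" for j
  proof (cases "j = n")
    case True
    then show ?thesis using h_pow_diag by (simp add: c_def)
  next
    case False
    then show ?thesis using that Suc.prems(2)[of j] h_pow_above[of n j] by simp
  qed
  ultimately obtain p where p: "act s (word_h p) (unit_vec (g 0)) = ?f" using Suc.IH by blast
  have "act s (word_h (p + monom c n)) (unit_vec (g 0)) = f"
    by (simp add: act_word_h_add act_word_h_monom p)
  then show ?case by blast
qed

lemma act_word_h_surj: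
  assumes f: "f \<in> S"
  shows "\<exists>p. act s (word_h p) (unit_vec (g 0)) = f"
proof -
  have "finite (g -` {n. f n \<noteq> 0})"
    using invariantD(1)[OF S f] g by (intro finite_vimageI) (auto simp: fin_supp_def)
  then obtain n where "\<And>j. j \<in> g -` {n. f n \<noteq> 0} \<Longrightarrow> j < n"
    by (meson finite_nat_set_iff_bounded)
  then have "f (g j) = 0" if "j \<ge> n" for j using that by (force simp: not_less[symmetric])
  then show ?thesis using act_word_h_surj_aux f by blast
qed

lemma has_rank_1: "has_rank (M_C l\<lparr>carrier := sub S\<rparr>) 1"
proof -
  let ?M = "M_C l\<lparr>carrier := sub S\<rparr>"
  interpret A: abelian_group ?M by (rule abelian_group_sub[OF S])
  interpret L: left_module U_sl2 ?M by (rule left_module_sub[OF S])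
  obtain b where b: "b \<in> carrier (M_C l)" "coords b = unit_vec (g 0)"
    using coords_surj[OF fin_supp_unit_vec] by blast
  then have bS: "b \<in> sub S" using start by (simp add: sub_def)
  have closed: "poly_h q \<odot>\<^bsub>M_C l\<^esub> b \<in> sub S" for q
    using L.smult_closed[of "poly_h q" b] bS by (simp add: poly_h_eq to_U_closed)
  \<comment> \<open>For rank 1 the only index is 0, and the sum over the basis collapses to one
    term.\<close>
  have fin: "(\<Oplus>\<^bsub>?M\<^esub>i\<in>{..<1::nat}. poly_h (p i) \<odot>\<^bsub>?M\<^esub> b) = poly_h (p 0) \<odot>\<^bsub>M_C l\<^esub> b" for p
    using A.finsum_insert[of "{}" 0 "\<lambda>i. poly_h (p i) \<odot>\<^bsub>M_C l\<^esub> b"] closed[of "p 0"] A.r_zero[of "poly_h (p 0) \<odot>\<^bsub>M_C l\<^esub> b"]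
    by (simp add: lessThan_Suc)
  have eq: "v = poly_h q \<odot>\<^bsub>M_C l\<^esub> b \<longleftrightarrow> act s (word_h q) (unit_vec (g 0)) = coords v" if "v \<in> sub S" for v q
  proof -
    have "v \<in> carrier (M_C l)" using that by (simp add: sub_def)
    then have "v = poly_h q \<odot>\<^bsub>M_C l\<^esub> b \<longleftrightarrow> coords v = coords (poly_h q \<odot>\<^bsub>M_C l\<^esub> b)"
      using coords_inject smult_M_C_closed b(1) by (simp add: poly_h_eq)
    then show ?thesis by (auto simp: poly_h_eq coords_smult b)
  qed
  have "\<exists>!p. p \<in> {..<1::nat} \<rightarrow>\<^sub>E (UNIV :: complex poly set) \<and> v = (\<Oplus>\<^bsub>?M\<^esub>i\<in>{..<1}. poly_h (p i) \<odot>\<^bsub>?M\<^esub> b)"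
    if v: "v \<in> sub S" for v
  proof -
    obtain q where q: "act s (word_h q) (unit_vec (g 0)) = coords v"
      using act_word_h_surj v by (auto simp: sub_def)
    show ?thesis
      unfolding fin eq[OF v]
    proof (rule ex1I)
      show "(\<lambda>i\<in>{..<1::nat}. q) \<in> {..<1} \<rightarrow>\<^sub>E UNIV \<and>
          act s (word_h ((\<lambda>i\<in>{..<1::nat}. q) 0)) (unit_vec (g 0)) = coords v"
        using q by simp
      fix p assume p: "p \<in> {..<1::nat} \<rightarrow>\<^sub>E UNIV \<and> act s (word_h (p 0)) (unit_vec (g 0)) = coords v"
      then have "p 0 = q" using q act_word_h_inject by metis
      then show "p = (\<lambda>i\<in>{..<1}. q)"
        using p by (intro PiE_ext[of p "{..<1}" "\<lambda>_. UNIV"]) auto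
    qed
  qed
  then show ?thesis
    unfolding has_rank_def using bS by (intro bexI[of _ "\<lambda>_. b"]) auto
qed

end

context casimir_module
begin

text \<open>The chains start at \<open>v_s\<close> and \<open>v_(-s)\<close> and move away from 0.
  At \<open>n = s + i + 1\<close> the formula for \<open>h\<close> has the coefficients
  \<open>2 * s + i\<close> and \<open>-i - 2\<close>; at \<open>n = -s - i - 1\<close> they are the
  same with the two neighbours exchanged.\<close>

lemma has_rank_PQ:
  "has_rank (M_C l\<lparr>carrier := sub (supported T_P)\<rparr>) 1"
  "has_rank (M_C l\<lparr>carrier := sub (supported T_Q)\<rparr>) 1"
proof -
  have nz: "of_int (2 * s + int i) \<noteq> (0 :: complex)" for i
    using s by (subst of_int_eq_0_iff) simp
  have P: "T_P = range (\<lambda>i. s + int i)"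
    by (auto simp: image_iff intro!: exI[of _ "nat (_ - s)"])
  interpret P: h_chain l s "\<lambda>i. s + int i" "supported T_P" "\<lambda>i. of_int (2 * s + int i)" "\<lambda>i. of_int (- int i - 2)"
    by unfold_locales
      (use P invariant_PQN(1) nz in \<open>auto simp: inj_def rep_mat_h algebra_simps simp del: of_int_add of_int_mult of_int_diff\<close>)
  show "has_rank (M_C l\<lparr>carrier := sub (supported T_P)\<rparr>) 1" by (rule P.has_rank_1)
  have Q: "T_Q = range (\<lambda>i. - s - int i)"
    by (auto simp: image_iff intro!: exI[of _ "nat (- s - _)"])
  interpret Q: h_chain l s "\<lambda>i. - s - int i" "supported T_Q" "\<lambda>i. of_int (2 * s + int i)" "\<lambda>i. of_int (- int i - 2)"
    by unfold_locales
      (use Q invariant_PQN(2) nz in \<open>auto simp: inj_def rep_mat_h algebra_simps simp del: of_int_add of_int_mult of_int_diff\<close>)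
  show "has_rank (M_C l\<lparr>carrier := sub (supported T_Q)\<rparr>) 1" by (rule Q.has_rank_1)
qed

end

section \<open>The grading\<close>

lemma UNIV_bit_pair: "(UNIV :: (bit \<times> bit) set) = {(0, 0), (0, 1), (1, 0), (1, 1)}"
proof -
  have "a = 0 \<or> a = 1" for a :: bit by (cases a) auto
  then show ?thesis by auto
qed

lemma finite_bit_pair [simp]: "finite (UNIV :: (bit \<times> bit) set)"
  by (simp add: UNIV_bit_pair)

lemma bit_pair_add_self: "k + (k + g) = (g :: bit \<times> bit)"
proof -
  have "a + (a + b) = b" for a b :: bit by (cases a; cases b) simp_all
  then show ?thesis by (cases k; cases g) simp
qed

lemma pauli_subset: "pauli d \<subseteq> sl2"
  by (auto simp: pauli_def) (simp_all add: sl2_iff mscale_def)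

lemma mats_in_pauli: "mat_h \<in> pauli (1, 0)" "mat_B \<in> pauli (0, 1)" "mat_C \<in> pauli (1, 1)"
proof -
  have "mscale 1 A = A" for A by (simp add: mscale_def vec_eq_iff)
  then show "mat_h \<in> pauli (1, 0)" "mat_B \<in> pauli (0, 1)" "mat_C \<in> pauli (1, 1)"
    by (auto simp: pauli_def image_iff intro!: exI[of _ 1])
qed

lemma homogeneous_wordE:
  assumes "w \<in> homogeneous_words g"
  obtains As gs where "w = Word As" "list_all2 (\<lambda>A d. A \<in> pauli d) As gs" "sum_list gs = g"
  using assms unfolding homogeneous_words_def by blast

lemma homogeneous_words_words_over:
  assumes "Poly_Mapping.keys p \<subseteq> homogeneous_words g"
  shows "p \<in> words_over sl2"
proof -
  have "set As \<subseteq> sl2" if "list_all2 (\<lambda>A d. A \<in> pauli d) As gs" for As gs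
    using that by (induction rule: list_all2_induct) (use pauli_subset in auto)
  then have "set (letters w) \<subseteq> sl2" if "w \<in> homogeneous_words g" for w
    using that by (elim homogeneous_wordE) simp
  then show ?thesis
    using assms unfolding words_over_iff by blast
qed

definition bit_sign :: "bit \<Rightarrow> complex" where
  "bit_sign b = (if b = 0 then 1 else - 1)"

text \<open>Reflection \<open>n \<mapsto> -n\<close> and the parity of \<open>n\<close> separate the four degrees.\<close>

definition hom_vec :: "bit \<times> bit \<Rightarrow> (int \<Rightarrow> complex) set" where
  "hom_vec g = {f. \<forall>n. f (- n) = bit_sign (snd g) * f n \<and>
     (even n \<noteq> (fst g + snd g = 0) \<longrightarrow> f n = 0)}"

lemma hom_vecI:
  assumes "\<And>n. f (- n) = bit_sign (snd g) * f n" "\<And>n. even n \<noteq> (fst g + snd g = 0) \<Longrightarrow> f n = 0"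
  shows "f \<in> hom_vec g"
  using assms by (simp add: hom_vec_def)

text \<open>Reflection exchanges the raising and lowering coefficients of \<open>rep\<close>. The
  sign \<open>t\<close> is 1 for multiples of \<open>h\<close> and -1 for multiples of B.\<close>

lemma rep_reflect:
  assumes f: "\<And>n. f (- n) = e * f n" and A: "coef_H A = 0" "coef_F A = t * coef_E A" and t: "t * t = 1"
  shows "rep s A f (- n) = t * e * rep s A f n"
proof -
  have 1: "f (- n - 1) = e * f (n + 1)" "f (1 - n) = e * f (n - 1)"
    using f[of "n + 1"] f[of "n - 1"] by simp_all
  have 2: "t * (t * x) = x" for x using t by (simp flip: mult.assoc)
  show ?thesis
    by (simp add: rep_def A 1 algebra_simps 2)
qed

text \<open>\<open>h\<close> changes parity and keeps the reflection sign, B changes both, and C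
  keeps parity and changes the sign because it multiplies by an odd function of \<open>n\<close>.
  These are the changes prescribed by the degrees.\<close>

lemma rep_hom_vec:
  assumes A: "A \<in> pauli d" and f: "f \<in> hom_vec g"
  shows "rep s A f \<in> hom_vec (d + g)"
proof -
  have refl: "f (- n) = bit_sign (snd g) * f n" for n using f by (simp add: hom_vec_def)
  define q where "q \<longleftrightarrow> fst g + snd g = 0"
  have par: "f n = 0" if "even n \<noteq> q" for n using f that by (simp add: hom_vec_def q_def)
  have sg: "bit_sign (snd ((1, 0) + g)) = bit_sign (snd g)"
    "bit_sign (snd ((0, 1) + g)) = - bit_sign (snd g)" "bit_sign (snd ((1, 1) + g)) = - bit_sign (snd g)"
    by (cases "snd g"; simp add: bit_sign_def)+
  have q: "fst ((1, 0) + g) + snd ((1, 0) + g) = 0 \<longleftrightarrow> \<not> q"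
    "fst ((0, 1) + g) + snd ((0, 1) + g) = 0 \<longleftrightarrow> \<not> q"
    "fst ((1, 1) + g) + snd ((1, 1) + g) = 0 \<longleftrightarrow> q"
    by (cases "fst g"; cases "snd g"; simp add: q_def)+
  consider a where "d = (1, 0)" "A = mscale a mat_h" | a where "d = (0, 1)" "A = mscale a mat_B"
    | a where "d = (1, 1)" "A = mscale a mat_C" | "d = (0, 0)" "A = 0"
  proof -
    have "d \<in> {(0, 0), (0, 1), (1, 0), (1, 1)}" using UNIV_bit_pair by auto
    then show thesis using A that by (auto simp: pauli_def split: if_splits)
  qed
  then show ?thesis
  proof cases
    case (1 a)
    have r: "rep s A f (- n) = 1 * bit_sign (snd g) * rep s A f n" for n
      by (rule rep_reflect) (simp_all add: refl 1 coef_mscale coef_mats)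
    have "rep s A f n = 0" if "even n \<noteq> (fst (d + g) + snd (d + g) = 0)" for n
    proof -
      have "even n = q" using that unfolding 1(1) q by simp
      then have "f (n - 1) = 0" "f (n + 1) = 0" by (auto intro!: par)
      then show ?thesis by (simp add: 1(2) rep_def coef_mscale coef_mats)
    qed
    moreover have "bit_sign (snd (d + g)) = 1 * bit_sign (snd g)" unfolding 1(1) sg by simp
    ultimately show ?thesis using r by (intro hom_vecI) (simp_all only:)
  next
    case (2 a)
    have r: "rep s A f (- n) = - 1 * bit_sign (snd g) * rep s A f n" for n
      by (rule rep_reflect) (simp_all add: refl 2 coef_mscale coef_mats)
    have "rep s A f n = 0" if "even n \<noteq> (fst (d + g) + snd (d + g) = 0)" for n
    proof -
      have "even n = q" using that unfolding 2(1) q by simp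
      then have "f (n - 1) = 0" "f (n + 1) = 0" by (auto intro!: par)
      then show ?thesis by (simp add: 2(2) rep_def coef_mscale coef_mats)
    qed
    moreover have "bit_sign (snd (d + g)) = - 1 * bit_sign (snd g)" unfolding 2(1) sg by simp
    ultimately show ?thesis using r by (intro hom_vecI) (simp_all only:)
  next
    case (3 a)
    have c: "rep s A f = (\<lambda>n. a * \<i> * of_int (2 * n) * f n)"
      by (simp add: 3 rep_def coef_mscale coef_mats)
    have "rep s A f n = 0" if "even n \<noteq> (fst (d + g) + snd (d + g) = 0)" for n
      using that par[of n] unfolding 3(1) q by (simp add: c)
    moreover have "rep s A f (- n) = bit_sign (snd (d + g)) * rep s A f n" for n
      unfolding 3(1) sg by (simp add: c refl)
    ultimately show ?thesis by (intro hom_vecI)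
  next
    case 4
    have "rep s A f = (\<lambda>n. 0)" by (simp add: 4 rep_def coef_E_def coef_F_def coef_H_def)
    then show ?thesis by (simp add: hom_vec_def)
  qed
qed

lemma foldr_rep_hom_vec:
  "list_all2 (\<lambda>A d. A \<in> pauli d) As gs \<Longrightarrow> foldr (rep s) As (unit_vec 0) \<in> hom_vec (sum_list gs)"
proof (induction rule: list_all2_induct)
  case Nil
  show ?case by (auto simp: hom_vec_def unit_vec_def bit_sign_def)
next
  case (Cons A As d gs)
  then show ?case by (simp add: rep_hom_vec)
qed

text \<open>The homogeneous components of the module in coordinates, as
  \<open>coords_component\<close> shows; \<open>hom_vec\<close> bounds them from above.\<close>

definition degree_part :: "int \<Rightarrow> bit \<times> bit \<Rightarrow> (int \<Rightarrow> complex) set" where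
  "degree_part s g = (\<lambda>p. act s p (unit_vec 0)) ` {p. Poly_Mapping.keys p \<subseteq> homogeneous_words g}"

lemma degree_part_hom_vec: "degree_part s g \<subseteq> hom_vec g"
proof
  fix f assume "f \<in> degree_part s g"
  then obtain p where p: "Poly_Mapping.keys p \<subseteq> homogeneous_words g" "f = act s p (unit_vec 0)"
    by (auto simp: degree_part_def)
  have w: "foldr (rep s) (letters w) (unit_vec 0) \<in> hom_vec g" if "w \<in> Poly_Mapping.keys p" for w
  proof -
    from that p(1) obtain As gs where "w = Word As" "list_all2 (\<lambda>A d. A \<in> pauli d) As gs" "sum_list gs = g"
      by (blast elim: homogeneous_wordE)
    then show ?thesis using foldr_rep_hom_vec[of As gs s] by simp
  qed
  show "f \<in> hom_vec g"
  proof (rule hom_vecI)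
    show "f (- n) = bit_sign (snd g) * f n" for n
      unfolding p(2) algebra_action_def sum_distrib_left
      by (intro sum.cong refl) (use w in \<open>simp add: hom_vec_def\<close>)
    show "f n = 0" if "even n \<noteq> (fst g + snd g = 0)" for n
      unfolding p(2) algebra_action_def
      by (intro sum.neutral ballI) (use w that in \<open>simp add: hom_vec_def\<close>)
  qed
qed

lemma degree_part_zero: "(\<lambda>n. 0) \<in> degree_part s g"
  by (auto simp: degree_part_def intro!: image_eqI[of _ _ 0])

lemma degree_part_unit: "unit_vec 0 \<in> degree_part s 0"
  unfolding degree_part_def
  by (rule image_eqI[of _ _ 1]) (auto simp: homogeneous_words_def zero_free_monoid_def intro!: exI[of _ "[]"])

lemma degree_part_add:
  assumes "f \<in> degree_part s g" "f' \<in> degree_part s g"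
  shows "(\<lambda>n. f n + f' n) \<in> degree_part s g"
proof -
  obtain p q where "Poly_Mapping.keys p \<subseteq> homogeneous_words g" "f = act s p (unit_vec 0)"
    "Poly_Mapping.keys q \<subseteq> homogeneous_words g" "f' = act s q (unit_vec 0)"
    using assms by (auto simp: degree_part_def)
  then show ?thesis
    unfolding degree_part_def using Poly_Mapping.keys_add[of p q]
    by (intro image_eqI[of _ _ "p + q"]) (auto simp: algebra_action_add)
qed

lemma degree_part_scale:
  assumes "f \<in> degree_part s g"
  shows "(\<lambda>n. a * f n) \<in> degree_part s g"
proof -
  obtain p where p: "Poly_Mapping.keys p \<subseteq> homogeneous_words g" "f = act s p (unit_vec 0)"
    using assms by (auto simp: degree_part_def)
  have "Poly_Mapping.keys (fconst a * p) \<subseteq> Poly_Mapping.keys p"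
    using Poly_Mapping.keys_mult[of "fconst a" p] by (auto simp: fconst_def split: if_splits)
  then show ?thesis
    unfolding degree_part_def using p
    by (intro image_eqI[of _ _ "fconst a * p"]) (auto simp: act_mult)
qed

lemma degree_part_rep:
  assumes A: "A \<in> pauli d" and "f \<in> degree_part s g"
  shows "rep s A f \<in> degree_part s (d + g)"
proof -
  obtain p where p: "Poly_Mapping.keys p \<subseteq> homogeneous_words g" "f = act s p (unit_vec 0)"
    using assms by (auto simp: degree_part_def)
  have "Poly_Mapping.keys (fgen A * p) \<subseteq> {Word [A] + w | w. w \<in> Poly_Mapping.keys p}"
    using Poly_Mapping.keys_mult[of "fgen A" p] by (auto simp: fgen_def)
  also have "\<dots> \<subseteq> homogeneous_words (d + g)"
  proof
    fix v assume "v \<in> {Word [A] + w | w. w \<in> Poly_Mapping.keys p}"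
    then obtain w where v: "v = Word [A] + w" "w \<in> homogeneous_words g" using p(1) by blast
    from v(2) obtain As gs where As: "w = Word As" "list_all2 (\<lambda>A d. A \<in> pauli d) As gs" "sum_list gs = g"
      by (rule homogeneous_wordE)
    have "v = Word (A # As)" by (simp add: v As plus_free_monoid_def)
    moreover have "list_all2 (\<lambda>A d. A \<in> pauli d) (A # As) (d # gs)" using A As(2) by simp
    moreover have "sum_list (d # gs) = d + g" by (simp add: As(3))
    ultimately show "v \<in> homogeneous_words (d + g)"
      unfolding homogeneous_words_def by blast
  qed
  finally show ?thesis
    unfolding degree_part_def using p(2)
    by (intro image_eqI[of _ _ "fgen A * p"]) (auto simp: act_mult)
qed

text \<open>The projection onto \<open>hom_vec g\<close>: restriction to one parity class, followed
  by the symmetric or antisymmetric part under reflection.\<close>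

definition hom_proj :: "bit \<times> bit \<Rightarrow> (int \<Rightarrow> complex) \<Rightarrow> int \<Rightarrow> complex" where
  "hom_proj g f n =
     (if even n = (fst g + snd g = 0) then (f n + bit_sign (snd g) * f (- n)) / 2 else 0)"

text \<open>At even points only the degrees (0,0) and (1,1) survive, at odd points only (1,0) and
  (0,1). In each pair one component is symmetric and the other antisymmetric, so \<open>f\<close> at
  \<open>n\<close> and \<open>-n\<close> determines both.\<close>

lemma hom_proj_unique:
  assumes d: "\<And>g. d g \<in> hom_vec g" and f: "f = (\<lambda>n. \<Sum>g\<in>UNIV. d g n)"
  shows "d g = hom_proj g f"
proof
  fix n
  have refl: "d g (- n) = bit_sign (snd g) * d g n" for g using d[of g] by (simp add: hom_vec_def)
  have par: "even n \<noteq> (fst g + snd g = 0) \<longrightarrow> d g n = 0" for g using d[of g] by (simp add: hom_vec_def)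
  have fn: "f m = d (0, 0) m + (d (0, 1) m + (d (1, 0) m + d (1, 1) m))" for m
    unfolding f UNIV_bit_pair by simp
  have "g \<in> {(0, 0), (0, 1), (1, 0), (1, 1)}" using UNIV_bit_pair by auto
  moreover have "bit_sign 0 = 1" "bit_sign 1 = - 1" by (simp_all add: bit_sign_def)
  ultimately show "d g n = hom_proj g f n"
    using par[of "(0, 0)"] par[of "(0, 1)"] par[of "(1, 0)"] par[of "(1, 1)"]
    by (cases "even n") (auto simp: hom_proj_def fn refl)
qed

lemma sl2_pauli_decomp:
  assumes "A \<in> sl2"
  shows "A = mscale (A $ 1 $ 1) mat_h + (mscale ((A $ 1 $ 2 + A $ 2 $ 1) / 2) mat_B
    + mscale ((A $ 1 $ 2 - A $ 2 $ 1) / 2) mat_C)"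
  using assms by (simp add: vec_eq_iff forall_2 sl2_iff mscale_def field_simps)

section \<open>The graded decomposition\<close>

context casimir_module
begin

text \<open>The vectors with a homogeneous decomposition form an invariant subspace that contains
  \<open>v_0\<close>, hence they are all finitely supported functions.\<close>

lemma degree_parts_sum:
  assumes "fin_supp f"
  shows "\<exists>d. (\<forall>g. d g \<in> degree_part s g) \<and> f = (\<lambda>n. \<Sum>g\<in>UNIV. d g n)"
proof -
  let ?D = "{f. fin_supp f \<and> (\<exists>d. (\<forall>g. d g \<in> degree_part s g) \<and> f = (\<lambda>n. \<Sum>g\<in>UNIV. d g n))}"
  have zero: "(\<lambda>n. 0) \<in> ?D"
    using degree_part_zero by (auto intro!: exI[of _ "\<lambda>g n. 0"])
  have add: "(\<lambda>n. f n + f' n) \<in> ?D" if "f \<in> ?D" "f' \<in> ?D" for f f'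
  proof -
    obtain d d' where "\<forall>g. d g \<in> degree_part s g" "f = (\<lambda>n. \<Sum>g\<in>UNIV. d g n)"
      "\<forall>g. d' g \<in> degree_part s g" "f' = (\<lambda>n. \<Sum>g\<in>UNIV. d' g n)"
      using \<open>f \<in> ?D\<close> \<open>f' \<in> ?D\<close> by blast
    then have X: "(\<forall>g. (\<lambda>n. d g n + d' g n) \<in> degree_part s g) \<and>
        (\<lambda>n. f n + f' n) = (\<lambda>n. \<Sum>g\<in>UNIV. d g n + d' g n)"
      by (simp add: degree_part_add sum.distrib)
    have fs: "fin_supp (\<lambda>n. f n + f' n)" using that fin_supp_add by blast
    show ?thesis by (rule CollectI, rule conjI, rule fs, rule exI[of _ "\<lambda>g n. d g n + d' g n"], rule X)
  qed
  have scale: "(\<lambda>n. a * f n) \<in> ?D" if "f \<in> ?D" for f a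
  proof -
    obtain d where "\<forall>g. d g \<in> degree_part s g" "f = (\<lambda>n. \<Sum>g\<in>UNIV. d g n)"
      using \<open>f \<in> ?D\<close> by blast
    then have X: "(\<forall>g. (\<lambda>n. a * d g n) \<in> degree_part s g) \<and> (\<lambda>n. a * f n) = (\<lambda>n. \<Sum>g\<in>UNIV. a * d g n)"
      by (simp add: degree_part_scale sum_distrib_left)
    have fs: "fin_supp (\<lambda>n. a * f n)" using that fin_supp_scale by blast
    show ?thesis by (rule CollectI, rule conjI, rule fs, rule exI[of _ "\<lambda>g n. a * d g n"], rule X)
  qed
  have hom: "rep s A f \<in> ?D" if A: "A \<in> pauli k" and "f \<in> ?D" for f A k
  proof -
    obtain d where d: "\<And>g. d g \<in> degree_part s g" "f = (\<lambda>n. \<Sum>g\<in>UNIV. d g n)"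
      using \<open>f \<in> ?D\<close> by blast
    have eq: "rep s A f n = (\<Sum>g\<in>UNIV. rep s A (d (k + g)) n)" for n
    proof -
      have "rep s A f n = (\<Sum>g\<in>UNIV. rep s A (d g) n)"
        by (simp add: d(2) rep_def sum.distrib sum_distrib_left)
      \<comment> \<open>Translation by \<open>k\<close> is its own inverse, so the component of
        degree \<open>g\<close> comes from the one of degree \<open>k + g\<close>.\<close>
      also have "\<dots> = (\<Sum>g\<in>UNIV. rep s A (d (k + g)) n)"
        by (rule sum.reindex_bij_witness[of _ "\<lambda>g. k + g" "\<lambda>g. k + g"]) (simp_all add: bit_pair_add_self)
      finally show ?thesis .
    qed
    have "rep s A (d (k + g)) \<in> degree_part s g" for g
      using degree_part_rep[OF A d(1)[of "k + g"]] by (simp add: bit_pair_add_self)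
    then have X: "(\<forall>g. rep s A (d (k + g)) \<in> degree_part s g) \<and> rep s A f = (\<lambda>n. \<Sum>g\<in>UNIV. rep s A (d (k + g)) n)"
      using eq by (intro conjI allI ext)
    have fs: "fin_supp (rep s A f)" using that fin_supp_rep by blast
    show ?thesis by (rule CollectI, rule conjI, rule fs, rule exI[of _ "\<lambda>g. rep s A (d (k + g))"], rule X)
  qed
  have "invariant ?D"
    unfolding invariant_def
  proof (intro conjI ballI allI zero add scale)
    fix f A assume f: "f \<in> ?D" and A: "A \<in> sl2"
    show "rep s A f \<in> ?D"
      by (subst sl2_pauli_decomp[OF A]) (simp only: rep_add rep_mscale,
        intro add scale hom[OF mats_in_pauli(1) f] hom[OF mats_in_pauli(2) f] hom[OF mats_in_pauli(3) f])
  qed auto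
  moreover have "unit_vec 0 \<in> ?D"
  proof -
    let ?d = "\<lambda>(g :: bit \<times> bit) n. if g = 0 then unit_vec 0 n else (0 :: complex)"
    have "?d g \<in> degree_part s g" for g :: "bit \<times> bit"
      using degree_part_unit[of s] degree_part_zero[of s g] by (cases "g = 0") simp_all
    moreover have "unit_vec 0 = (\<lambda>n. \<Sum>g\<in>(UNIV :: (bit \<times> bit) set). ?d g n)"
      by simp
    ultimately have X: "(\<forall>g. ?d g \<in> degree_part s g) \<and> unit_vec 0 = (\<lambda>n. \<Sum>g\<in>UNIV. ?d g n)"
      by (intro conjI allI)
    show ?thesis by (rule CollectI, rule conjI, rule fin_supp_unit_vec, rule exI[of _ ?d], rule X)
  qed
  ultimately have "f \<in> ?D" using generated_by_unit[OF _ _ assms] by blast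
  then show ?thesis by blast
qed

lemma coords_finsum:
  assumes "finite I" "\<And>i. i \<in> I \<Longrightarrow> d i \<in> carrier (M_C l)"
  shows "finsum (M_C l) d I \<in> carrier (M_C l) \<and> coords (finsum (M_C l) d I) = (\<lambda>n. \<Sum>i\<in>I. coords (d i) n)"
proof -
  interpret A: abelian_group "M_C l"
    using abelian_group_sub[OF invariant_PQN(4)] by (simp add: sub_UNIV)
  show ?thesis
    using assms
    by (induction I rule: finite_induct) (simp_all add: coords_zero coords_add)
qed

lemma M_C_component_eq: "M_C_component l g = word_M l ` {p. Poly_Mapping.keys p \<subseteq> homogeneous_words g}"
  by (auto simp: M_C_component_def U_component_def word_M_def word_I_def)

lemma component_carrier: "v \<in> M_C_component l g \<Longrightarrow> v \<in> carrier (M_C l)"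
  unfolding M_C_component_eq in_carrier_M_C using homogeneous_words_words_over by blast

lemma coords_component: "coords ` M_C_component l g = degree_part s g"
  unfolding M_C_component_eq degree_part_def image_image
  by (intro image_cong refl) (metis coords_word_M homogeneous_words_words_over mem_Collect_eq)

text \<open>The decomposition of the whole module restricts to \<open>N\<close>, because the
  projections use only the values at \<open>n\<close> and \<open>-n\<close> and the index set of
  \<open>N\<close> is symmetric.\<close>

lemma graded_N: "graded_submodule (M_C_component l) (sub (supported (T_P \<union> T_Q))) U_sl2 (M_C l)"
  unfolding graded_submodule_def
proof (intro conjI ballI)
  let ?N = "sub (supported (T_P \<union> T_Q))"
  show "submodule ?N U_sl2 (M_C l)"
    using maximal_submodule_iff maximal_submodule_def by blast
  fix w assume w: "w \<in> ?N"
  then have wc: "w \<in> carrier (M_C l)" and wN: "coords w \<in> supported (T_P \<union> T_Q)" by (auto simp: sub_def)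
  obtain d where d: "\<And>g. d g \<in> degree_part s g" "coords w = (\<lambda>n. \<Sum>g\<in>UNIV. d g n)"
    using degree_parts_sum[OF fin_supp_coords[OF wc]] by blast
  have dp: "d g = hom_proj g (coords w)" for g
    using d(1) degree_part_hom_vec by (intro hom_proj_unique[OF _ d(2)]) blast
  have "\<exists>v. v \<in> M_C_component l g \<and> coords v = d g" for g
    using d(1)[of g] unfolding coords_component[symmetric] by auto
  then obtain v where v: "\<And>g. v g \<in> M_C_component l g" "\<And>g. coords (v g) = d g" by metis
  have vc: "v g \<in> carrier (M_C l)" for g using component_carrier[OF v(1)] .
  have vN: "v g \<in> ?N" for g
  proof -
    have "d g n = 0" if "n \<notin> T_P \<union> T_Q" for n
    proof -
      have "- n \<notin> T_P \<union> T_Q" using that by auto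
      then show ?thesis using wN that by (simp add: dp hom_proj_def supported_def)
    qed
    moreover have "fin_supp (d g)" using fin_supp_coords[OF vc[of g]] by (simp add: v(2))
    ultimately show ?thesis using vc by (simp add: sub_def supported_def v(2))
  qed
  show "\<exists>!d. (\<forall>g. d g \<in> ?N \<inter> M_C_component l g) \<and> w = (\<Oplus>\<^bsub>M_C l\<^esub>g\<in>UNIV. d g)"
  proof (rule ex1I[of _ v])
    have fs: "finsum (M_C l) v UNIV \<in> carrier (M_C l)" "coords (finsum (M_C l) v UNIV) = coords w"
      using coords_finsum[of UNIV v] vc by (simp_all add: v(2) d(2))
    then have "w = finsum (M_C l) v UNIV" using coords_inject[OF wc fs(1)] by simp
    then show "(\<forall>g. v g \<in> ?N \<inter> M_C_component l g) \<and> w = (\<Oplus>\<^bsub>M_C l\<^esub>g\<in>UNIV. v g)"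
      using vN v(1) by blast
  next
    fix u assume u: "(\<forall>g. u g \<in> ?N \<inter> M_C_component l g) \<and> w = (\<Oplus>\<^bsub>M_C l\<^esub>g\<in>UNIV. u g)"
    then have uc: "u g \<in> carrier (M_C l)" for g using component_carrier by blast
    have "coords w = (\<lambda>n. \<Sum>g\<in>UNIV. coords (u g) n)"
      using u coords_finsum[of UNIV u] uc by simp
    moreover have "coords (u g) \<in> hom_vec g" for g
    proof -
      have "coords (u g) \<in> degree_part s g" unfolding coords_component[symmetric] using u by blast
      then show ?thesis using degree_part_hom_vec by blast
    qed
    ultimately have eq: "coords (u g) = hom_proj g (coords w)" for g
      using hom_proj_unique[of "\<lambda>g. coords (u g)"] by blast
    show "u = v"
    proof
      show "u g = v g" for g
        using eq[of g] coords_inject[OF uc vc, of g g] by (simp add: v(2) dp)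
    qed
  qed
qed

end

theorem theorem3p2:
  fixes l :: complex
  assumes "\<exists>k::int. l = of_int (2 * k)"
  shows "\<exists>N. (\<forall>N'. maximal_submodule N' U_sl2 (M_C l) \<longleftrightarrow> N' = N) \<and>
           graded_submodule (M_C_component l) N U_sl2 (M_C l) \<and>
           (\<exists>P Q. submodule P U_sl2 (M_C l) \<and> submodule Q U_sl2 (M_C l) \<and>
              internal_direct_sum (M_C l) N P Q \<and>
              simple_module U_sl2 (M_C l\<lparr>carrier := P\<rparr>) \<and> has_rank (M_C l\<lparr>carrier := P\<rparr>) 1 \<and>
              simple_module U_sl2 (M_C l\<lparr>carrier := Q\<rparr>) \<and> has_rank (M_C l\<lparr>carrier := Q\<rparr>) 1)"
proof -
  obtain k :: int where k: "l = of_int (2 * k)" using assms by blast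
  \<comment> \<open>Here \<open>l + 1 = 2 * k + 1\<close>, and \<open>2 * s - 1\<close> equals
    \<open>l + 1\<close> when \<open>k\<close> is nonnegative and \<open>-(l + 1)\<close> otherwise,
    so \<open>s\<close> is at least 1 in both cases.\<close>
  define s where "s = (if k \<ge> 0 then k + 1 else - k)"
  have "(l + 1)\<^sup>2 = (2 * of_int s - 1)\<^sup>2"
    by (simp add: k s_def power2_eq_square algebra_simps)
  then interpret casimir_module l s
    by unfold_locales (auto simp: s_def)
  have sub: "submodule (sub S) U_sl2 (M_C l)" if "invariant S" for S
  proof -
    have "S \<subseteq> supported UNIV" using invariantD(1)[OF that] by (auto simp: supported_UNIV)
    from submodule_sub[OF that invariant_PQN(4) this] show ?thesis by (simp only: sub_UNIV)
  qed
  show ?thesis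
    by (intro exI[of _ "sub (supported (T_P \<union> T_Q))"] exI[of _ "sub (supported T_P)"]
        exI[of _ "sub (supported T_Q)"] conjI allI maximal_submodule_iff graded_N sub invariant_PQN
        direct_sum_PQ simple_PQ has_rank_PQ)
qed

end
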